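(* There exists $M>0$ such that for every $L\in\mathbb{N}$ with $L>M$ and every integer $d\geq 3$, there exist two ergodic measure preserving transformations $T,S$ of a standard probability space $(X,\mathcal{X},\mu)$, with $h_\mu(X,T)=h_\mu(X,S)=0$, and $A\in\mathcal{X}$ with $\mu(A)>0$, such that for all $n\in\mathbb{N}$, $$\mu\left(A\cap T^{-Ln^d}A\cap S^{-Ln^d}A\right)=0.$$
   Context: $h_\mu(X,T)$ denotes the measure-theoretic (Kolmogorov–Sinai) entropy of $T$ with respect to $\mu$. $\mathbb{N}=\{1,2,\ldots\}$. $T$ and $S$ are not assumed to commute. *)

theory Defs
  imports "HOL-Probability.Probability"
begin

text \<open>
  The topology is existentially quantified, so that the space may be any measure on the ambient
  type and need not carry a type-class topology.
\<close>

definition standard_probability_space :: "'a measure \<Rightarrow> bool" where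
  "standard_probability_space M \<longleftrightarrow>
     prob_space M \<and>
     (\<exists>\<tau> :: 'a topology. topspace \<tau> = space M \<and>
        completely_metrizable_space \<tau> \<and> second_countable \<tau> \<and>
        sets M = sigma_sets (space M) {U. openin \<tau> U})"

definition measure_preserving_map :: "'a measure \<Rightarrow> ('a \<Rightarrow> 'a) \<Rightarrow> bool" where
  "measure_preserving_map M T \<longleftrightarrow>
     T \<in> measurable M M \<and>
     (\<forall>A \<in> sets M. emeasure M (T -` A \<inter> space M) = emeasure M A)"

definition ergodic_map :: "'a measure \<Rightarrow> ('a \<Rightarrow> 'a) \<Rightarrow> bool" where
  "ergodic_map M T \<longleftrightarrow>
     measure_preserving_map M T \<and>
     (\<forall>A \<in> sets M. T -` A \<inter> space M = A \<longrightarrow> measure M A = 0 \<or> measure M A = 1)"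

definition finite_measurable_partition :: "'a measure \<Rightarrow> 'a set set \<Rightarrow> bool" where
  "finite_measurable_partition M P \<longleftrightarrow> finite P \<and> P \<subseteq> sets M \<and> partition_on (space M) P"

text \<open>Null cells contribute \<open>0\<close>, since \<open>0 * ln 0 = 0\<close>.\<close>

definition partition_entropy :: "'a measure \<Rightarrow> 'a set set \<Rightarrow> real" where
  "partition_entropy M P = - (\<Sum>A\<in>P. measure M A * ln (measure M A))"

text \<open>
  The join of \<open>P\<close>, \<open>T\<^sup>-\<^sup>1 P\<close>, \<dots>, \<open>T\<^sup>-\<^sup>(\<^sup>n\<^sup>-\<^sup>1\<^sup>) P\<close>. The pulled-back families may contain the
  empty set, which \<open>common_refinement\<close> discards from the join.
\<close>

definition iterated_join :: "'a measure \<Rightarrow> ('a \<Rightarrow> 'a) \<Rightarrow> 'a set set \<Rightarrow> nat \<Rightarrow> 'a set set" where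
  "iterated_join M T P n =
     common_refinement ((\<lambda>i. (\<lambda>A. (T ^^ i) -` A \<inter> space M) ` P) ` {..<n})"

text \<open>
  For measure preserving \<open>T\<close> the sequence below converges by subadditivity, so \<open>lim\<close> denotes a
  genuine limit.
\<close>

definition entropy_wrt_partition :: "'a measure \<Rightarrow> ('a \<Rightarrow> 'a) \<Rightarrow> 'a set set \<Rightarrow> real" where
  "entropy_wrt_partition M T P =
     lim (\<lambda>n. partition_entropy M (iterated_join M T P n) / real n)"

definition ks_entropy :: "'a measure \<Rightarrow> ('a \<Rightarrow> 'a) \<Rightarrow> ereal" where
  "ks_entropy M T =
     (SUP P \<in> {P. finite_measurable_partition M P}. ereal (entropy_wrt_partition M T P))"

end

theory Submission
  imports Defs
begin

text \<open>
  The transformation \<open>T\<close> lets an observer wander along a bi-infinite sequence of fair coins. A point is a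
  pair \<open>(d, x)\<close> of a digit sequence \<open>d\<close> and coins \<open>x :: int \<Rightarrow> bool\<close>; \<open>T\<close> adds one to \<open>d\<close> with carry (an
  odometer) and translates \<open>x\<close> by an integer \<open>cocycle d\<close>. The cocycle is a formal coboundary: digit \<open>k\<close>
  takes \<open>(k + 2) * q k\<close> values, and the observer at \<open>d\<close> stands at the divergent sum over \<open>k\<close> of
  \<open>(d k mod q k) * sites k\<close> with \<open>sites k = q 0 * \<dots> * q (k - 1)\<close>. Along an orbit all but finitely many
  digits agree, so displacements are finite. Three facts make the construction work.

  First, let \<open>h k\<close> be the number of values of the first \<open>k\<close> digits. After \<open>q k * h k\<close> steps digit \<open>k\<close> has
  grown by \<open>q k\<close>, so that the observer is back at its site, unless a carry occurs, which has
  probability \<open>1 / (k + 2)\<close>. Hence \<open>T\<close> is rigid (\<open>rigid_T\<close>), and rigid maps have entropy \<open>0\<close>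
  (\<open>ks_entropy_rigid\<close>).

  Secondly, the observer can be back at its site only at times of the form \<open>\<Sum>k. j k * q k * h k\<close> with
  \<open>\<bar>j k\<bar> < k + 2\<close>. The factors \<open>q k\<close> are chosen one after the other, and a counting argument
  (\<open>sparse_multiple_exists\<close>) shows that they can be chosen so that none of these times, other than \<open>0\<close>,
  belongs to a given sequence \<open>a\<close> with \<open>a n \<ge> n\<^sup>2\<close>, such as \<open>a n = L * n ^ d\<close> (\<open>no_return\<close>).

  Thirdly, \<open>T\<close> is ergodic (\<open>ergodic_T\<close>): an invariant set is also invariant under maps that permute the
  positions in a long block and move the observer far away, and averaging over such maps makes a
  cylinder set independent of its preimage.

  Let \<open>S\<close> be the conjugate of \<open>T\<close> by the involution \<open>flip_map\<close>, which turns over every coin except the one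
  at the origin, and let \<open>A\<close> be the set of points with heads at the origin. If the observer of \<open>T\<close> has
  moved by \<open>c\<close> after \<open>a n\<close> steps, then the point is in \<open>A\<close> at that time iff the coin at \<open>c\<close> shows heads,
  whereas for \<open>S\<close>, because \<open>c \<noteq> 0\<close>, it is in \<open>A\<close> iff this same coin shows tails. So \<open>A\<close> and its two
  preimages have no point in common, up to a null set on which carries never stop. An injection of the
  space into the reals (\<open>standard_embed_measure\<close>) then transports everything to a measure on \<open>real\<close>.
\<close>

section \<open>Rigid transformations have entropy zero\<close>

lemma continuous_on_entropy_fun: "continuous_on {0::real..} (\<lambda>t. - (t * ln t))"
proof -
  have "((\<lambda>t. - (t * ln t)) \<longlongrightarrow> - (x * ln x)) (at x within {0..})" if "x \<ge> 0" for x :: real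
  proof (cases "x = 0")
    case True
    have "((\<lambda>t::real. - (t * ln t)) \<longlongrightarrow> 0) (at_right 0)" by real_asymp
    moreover have "at 0 within {0..} = at_right (0::real)"
      by (rule at_within_nhd[of _ "{-1<..<1}"]) auto
    ultimately show ?thesis using True by simp
  next
    case False
    with that have "x > 0" by simp
    then show ?thesis by (intro tendsto_intros) auto
  qed
  then show ?thesis by (auto simp: continuous_on_def)
qed

text \<open>
  In terms of random variables, with joint weights \<open>p l y\<close> of \<open>l\<close> and \<open>y\<close>: conditioning on \<open>l\<close> leaves at
  most as much entropy in \<open>y\<close> as conditioning on the function \<open>g l\<close> of it. Collecting all logarithms
  over the joint law of \<open>(l, y)\<close> gives a sum to which \<open>ln t \<le> t - 1\<close> applies termwise.
\<close>

lemma entropy_increment_le: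
  fixes p :: "'a \<Rightarrow> 'b \<Rightarrow> real" and g :: "'a \<Rightarrow> 'c"
  assumes fin: "finite A" "finite B" "finite Z" and g: "g ` A \<subseteq> Z"
    and p: "\<And>l y. p l y \<ge> 0"
    and P: "\<And>l. l \<in> A \<Longrightarrow> P l = (\<Sum>y\<in>B. p l y)"
    and pz: "\<And>z. z \<in> Z \<Longrightarrow> pz z = (\<Sum>l\<in>{l\<in>A. g l = z}. P l)"
    and pzy: "\<And>z y. z \<in> Z \<Longrightarrow> y \<in> B \<Longrightarrow> pzy z y = (\<Sum>l\<in>{l\<in>A. g l = z}. p l y)"
  shows "(\<Sum>l\<in>A. \<Sum>y\<in>B. - (p l y * ln (p l y))) - (\<Sum>l\<in>A. - (P l * ln (P l)))
       \<le> (\<Sum>z\<in>Z. \<Sum>y\<in>B. - (pzy z y * ln (pzy z y))) - (\<Sum>z\<in>Z. - (pz z * ln (pz z)))"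
proof -
  have P0: "P l \<ge> 0" if "l \<in> A" for l using that p by (simp add: P sum_nonneg)
  have pzy0: "pzy z y \<ge> 0" if "z \<in> Z" "y \<in> B" for z y using that p by (simp add: pzy sum_nonneg)
  have pz0: "pz z \<ge> 0" if "z \<in> Z" for z using that P0 by (auto simp: pz intro!: sum_nonneg)
  have gr: "(\<Sum>z\<in>Z. \<Sum>l\<in>{l\<in>A. g l = z}. f l) = sum f A" for f :: "'a \<Rightarrow> real"
    by (rule sum.group[OF fin(1) fin(3) g])
  have e1: "(\<Sum>l\<in>A. P l * ln (P l)) = (\<Sum>l\<in>A. \<Sum>y\<in>B. p l y * ln (P l))"
    by (intro sum.cong refl) (simp add: P sum_distrib_right)
  have e2: "(\<Sum>z\<in>Z. pz z * ln (pz z)) = (\<Sum>l\<in>A. \<Sum>y\<in>B. p l y * ln (pz (g l)))"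
  proof -
    have "(\<Sum>z\<in>Z. pz z * ln (pz z)) = (\<Sum>z\<in>Z. \<Sum>l\<in>{l\<in>A. g l = z}. P l * ln (pz (g l)))"
      by (intro sum.cong refl) (simp add: pz sum_distrib_right)
    also have "\<dots> = (\<Sum>l\<in>A. P l * ln (pz (g l)))" by (rule gr)
    also have "\<dots> = (\<Sum>l\<in>A. \<Sum>y\<in>B. p l y * ln (pz (g l)))"
      by (intro sum.cong refl) (simp add: P sum_distrib_right)
    finally show ?thesis .
  qed
  have e3: "(\<Sum>z\<in>Z. \<Sum>y\<in>B. pzy z y * ln (pzy z y)) = (\<Sum>l\<in>A. \<Sum>y\<in>B. p l y * ln (pzy (g l) y))"
  proof -
    have "(\<Sum>z\<in>Z. \<Sum>y\<in>B. pzy z y * ln (pzy z y))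
        = (\<Sum>z\<in>Z. \<Sum>y\<in>B. \<Sum>l\<in>{l\<in>A. g l = z}. p l y * ln (pzy (g l) y))"
      by (intro sum.cong refl) (simp add: pzy sum_distrib_right)
    also have "\<dots> = (\<Sum>z\<in>Z. \<Sum>l\<in>{l\<in>A. g l = z}. \<Sum>y\<in>B. p l y * ln (pzy (g l) y))"
      by (intro sum.cong refl sum.swap)
    also have "\<dots> = (\<Sum>l\<in>A. \<Sum>y\<in>B. p l y * ln (pzy (g l) y))" by (rule gr)
    finally show ?thesis .
  qed
  have t: "p l y * (ln (P l) + ln (pzy (g l) y) - ln (p l y) - ln (pz (g l)))
      \<le> P l * (pzy (g l) y / pz (g l)) - p l y" if l: "l \<in> A" and y: "y \<in> B" for l y
  proof (cases "p l y = 0")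
    case True
    have "g l \<in> Z" using l g by auto
    then show ?thesis using True P0[OF l] pzy0[OF _ y] pz0 by simp
  next
    case False
    then have pp: "p l y > 0" using p[of l y] by simp
    have gZ: "g l \<in> Z" using l g by auto
    have "p l y \<le> P l" unfolding P[OF l] by (rule member_le_sum) (use y p fin in auto)
    then have PP: "P l > 0" using pp by simp
    have "p l y \<le> pzy (g l) y" unfolding pzy[OF gZ y]
      by (rule member_le_sum[of l _ "\<lambda>l. p l y"]) (use l p fin in auto)
    then have zy: "pzy (g l) y > 0" using pp by simp
    have "P l \<le> pz (g l)" unfolding pz[OF gZ]
      by (rule member_le_sum[of l _ P]) (use l P0 fin in auto)
    then have zz: "pz (g l) > 0" using PP by simp
    \<comment> \<open>the ratio of the product law to the joint law\<close>
    let ?x = "P l * pzy (g l) y / (p l y * pz (g l))"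
    have "ln ?x \<le> ?x - 1" using pp PP zy zz by (intro ln_le_minus_one) simp
    moreover have "ln ?x = ln (P l) + ln (pzy (g l) y) - ln (p l y) - ln (pz (g l))"
      using pp PP zy zz by (simp add: ln_div ln_mult)
    ultimately have "p l y * (ln (P l) + ln (pzy (g l) y) - ln (p l y) - ln (pz (g l))) \<le> p l y * (?x - 1)"
      using pp by (intro mult_left_mono) auto
    also have "\<dots> = P l * (pzy (g l) y / pz (g l)) - p l y"
      using pp zz by (simp add: field_simps)
    finally show ?thesis .
  qed
  have "(\<Sum>l\<in>A. \<Sum>y\<in>B. p l y * (ln (P l) + ln (pzy (g l) y) - ln (p l y) - ln (pz (g l))))
      \<le> (\<Sum>l\<in>A. \<Sum>y\<in>B. P l * (pzy (g l) y / pz (g l)) - p l y)"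
    by (intro sum_mono t)
  also have "\<dots> = (\<Sum>l\<in>A. P l * ((\<Sum>y\<in>B. pzy (g l) y) / pz (g l)) - P l)"
    by (intro sum.cong refl) (simp add: sum_subtractf P sum_distrib_left sum_divide_distrib)
  also have "\<dots> \<le> 0"
  proof (rule sum_nonpos)
    fix l assume l: "l \<in> A"
    then have gZ: "g l \<in> Z" using g by auto
    have "(\<Sum>y\<in>B. pzy (g l) y) = pz (g l)"
    proof -
      have "(\<Sum>y\<in>B. pzy (g l) y) = (\<Sum>l'\<in>{l'\<in>A. g l' = g l}. \<Sum>y\<in>B. p l' y)"
        using gZ by (simp add: pzy sum.swap[of _ _ B])
      also have "\<dots> = pz (g l)" using gZ by (simp add: pz P)
      finally show ?thesis .
    qed
    then show "P l * ((\<Sum>y\<in>B. pzy (g l) y) / pz (g l)) - P l \<le> 0"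
      using P0[OF l] by (cases "pz (g l) = 0") auto
  qed
  finally have "(\<Sum>l\<in>A. \<Sum>y\<in>B. p l y * ln (P l)) + (\<Sum>l\<in>A. \<Sum>y\<in>B. p l y * ln (pzy (g l) y))
     - (\<Sum>l\<in>A. \<Sum>y\<in>B. p l y * ln (p l y)) - (\<Sum>l\<in>A. \<Sum>y\<in>B. p l y * ln (pz (g l))) \<le> 0"
    by (simp add: algebra_simps sum.distrib sum_subtractf)
  then show ?thesis by (simp add: sum_negf e1 e2 e3)
qed

text \<open>
  The lists \<open>l\<close> of partition cells of length \<open>n\<close> index the cells of the join of \<open>n\<close> preimages; unlike the
  cells themselves, they can be extended at the end, which turns the growth of the entropy in \<open>n\<close> into
  a sum over one more letter.
\<close>

definition itinerary_cell :: "'a measure \<Rightarrow> ('a \<Rightarrow> 'a) \<Rightarrow> 'a set list \<Rightarrow> 'a set" where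
  "itinerary_cell M T l = {x \<in> space M. \<forall>i<length l. (T ^^ i) x \<in> l ! i}"

lemma iterated_join_eq_itinerary_cells:
  assumes P: "partition_on (space M) P" and T: "T \<in> measurable M M" and n: "n > 0"
  shows "iterated_join M T P n = itinerary_cell M T ` {l. set l \<subseteq> P \<and> length l = n} - {{}}"
proof -
  define Q where "Q i = (\<lambda>A. (T ^^ i) -` A \<inter> space M) ` P" for i
  have J: "iterated_join M T P n = (\<Union>f \<in> (\<Pi> R\<in>Q ` {..<n}. R). {\<Inter> (f ` Q ` {..<n})}) - {{}}"
    unfolding iterated_join_def common_refinement Q_def[symmetric] ..
  show ?thesis
  proof (intro equalityI subsetI)
    fix C assume "C \<in> iterated_join M T P n"
    then obtain f where f: "\<And>i. i < n \<Longrightarrow> f (Q i) \<in> Q i" and C: "C = \<Inter> (f ` Q ` {..<n})" "C \<noteq> {}"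
      unfolding J by auto
    have "\<forall>i. \<exists>A. i < n \<longrightarrow> A \<in> P \<and> f (Q i) = (T ^^ i) -` A \<inter> space M"
      using f unfolding Q_def by blast
    then obtain A where A: "\<And>i. i < n \<Longrightarrow> A i \<in> P" "\<And>i. i < n \<Longrightarrow> f (Q i) = (T ^^ i) -` A i \<inter> space M"
      by metis
    have "C = itinerary_cell M T (map A [0..<n])"
      using n A(2) by (auto simp: C(1) itinerary_cell_def)
    moreover have "map A [0..<n] \<in> {l. set l \<subseteq> P \<and> length l = n}" using A(1) by auto
    ultimately show "C \<in> itinerary_cell M T ` {l. set l \<subseteq> P \<and> length l = n} - {{}}" using C(2) by blast
  next
    fix C assume "C \<in> itinerary_cell M T ` {l. set l \<subseteq> P \<and> length l = n} - {{}}"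
    then obtain l x where l: "set l \<subseteq> P" "length l = n" and C: "C = itinerary_cell M T l" and x: "x \<in> C"
      by auto
    define B where "B i = (T ^^ i) -` (l ! i) \<inter> space M" for i
    have lP: "l ! i \<in> P" if "i < n" for i using l that by auto
    have xB: "x \<in> B i" if "i < n" for i using x that l by (auto simp: C itinerary_cell_def B_def)
    have BQ: "B i \<in> Q i" if "i < n" for i using lP[OF that] by (auto simp: B_def Q_def)
    \<comment> \<open>Cells of one pulled-back partition are disjoint, so \<open>x\<close> determines the cell.\<close>
    have uniq: "D = B i" if i: "i < n" and D: "D \<in> Q i" "x \<in> D" for D i
    proof -
      obtain E where E: "E \<in> P" "D = (T ^^ i) -` E \<inter> space M" using D(1) by (auto simp: Q_def)
      have "(T ^^ i) x \<in> E \<inter> l ! i" using D(2) E xB[OF i] by (auto simp: B_def)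
      then have "E = l ! i" using P E(1) lP[OF i] by (auto simp: partition_on_def disjoint_def)
      then show ?thesis by (simp add: E B_def)
    qed
    define f where "f R = (SOME D. D \<in> R \<and> x \<in> D)" for R
    have f: "f (Q i) = B i" if i: "i < n" for i
    proof -
      have "f (Q i) \<in> Q i \<and> x \<in> f (Q i)" unfolding f_def
        by (rule someI[of _ "B i"]) (use BQ xB i in auto)
      then show ?thesis using uniq i by auto
    qed
    have "C = \<Inter> (f ` Q ` {..<n})"
      using n l by (auto simp: C itinerary_cell_def f B_def)
    moreover have "f \<in> (\<Pi> R\<in>Q ` {..<n}. R)" using f BQ by auto
    ultimately show "C \<in> iterated_join M T P n" using x unfolding J by blast
  qed
qed

text \<open>
  One sequence of times has to serve all measurable sets, so that it also serves all cells of a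
  partition at once. Times \<open>0\<close> are excluded because they would make every map rigid.
\<close>

definition rigid_map :: "'a measure \<Rightarrow> ('a \<Rightarrow> 'a) \<Rightarrow> bool" where
  "rigid_map M T \<longleftrightarrow> (\<exists>m :: nat \<Rightarrow> nat. (\<forall>k. m k \<ge> 1) \<and>
     (\<forall>A \<in> sets M. (\<lambda>k. measure M (A \<inter> ((T ^^ m k) -` A \<inter> space M))) \<longlonglongrightarrow> measure M A))"

lemma measure_preserving_map_iterate:
  assumes "measure_preserving_map M T"
  shows "T ^^ n \<in> measurable M M"
    and "A \<in> sets M \<Longrightarrow> measure M ((T ^^ n) -` A \<inter> space M) = measure M A"
proof -
  have T: "T \<in> measurable M M" using assms by (simp add: measure_preserving_map_def)
  show m: "T ^^ n \<in> measurable M M" for n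
    using T by (induction n) auto
  show "measure M ((T ^^ n) -` A \<inter> space M) = measure M A" if A: "A \<in> sets M"
  proof (induction n)
    case (Suc n)
    have "(T ^^ Suc n) -` A \<inter> space M = T -` ((T ^^ n) -` A \<inter> space M) \<inter> space M"
      using measurable_space[OF T] by (simp only: funpow_Suc_right) auto
    then show ?case
      using assms Suc measurable_sets[OF m[of n] A] unfolding measure_preserving_map_def measure_def by metis
  next
    case 0
    then show ?case using sets.sets_into_space[OF A] by (simp add: Int_absorb2)
  qed
qed

context
  fixes M :: "'a measure" and T P
  assumes prob: "prob_space M" and mp: "measure_preserving_map M T"
    and P: "finite_measurable_partition M P"
begin

interpretation prob_space M by (rule prob)

definition word_entropy :: "nat \<Rightarrow> real" where
  "word_entropy n = (\<Sum>l | set l \<subseteq> P \<and> length l = n.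
     - (prob (itinerary_cell M T l) * ln (prob (itinerary_cell M T l))))"

lemma partition_props: "finite P" "A \<in> P \<Longrightarrow> A \<in> events" "partition_on (space M) P"
  using P by (auto simp: finite_measurable_partition_def)

lemma meas_pow: "(T ^^ n) \<in> measurable M M"
  using mp by (rule measure_preserving_map_iterate)

lemma itinerary_cell_events: "set l \<subseteq> P \<Longrightarrow> itinerary_cell M T l \<in> events"
proof -
  assume l: "set l \<subseteq> P"
  have "{x \<in> space M. (T ^^ i) x \<in> l ! i} \<in> events" if "i < length l" for i
  proof -
    have "l ! i \<in> events" using l that by (intro partition_props(2)) auto
    from measurable_sets[OF meas_pow this] show ?thesis by (simp add: vimage_def Int_def conj_commute)
  qed
  then have "{x \<in> space M. \<forall>i\<in>{..<length l}. (T ^^ i) x \<in> l ! i} \<in> events"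
    by (intro sets.sets_Collect_finite_All) (simp_all only: lessThan_iff finite_lessThan)
  moreover have "itinerary_cell M T l = {x \<in> space M. \<forall>i\<in>{..<length l}. (T ^^ i) x \<in> l ! i}"
    unfolding itinerary_cell_def by blast
  ultimately show ?thesis by simp
qed

lemma partition_entropy_iterated_join:
  assumes n: "n > 0"
  shows "partition_entropy M (iterated_join M T P n) = word_entropy n"
proof -
  let ?L = "{l. set l \<subseteq> P \<and> length l = n}"
  let ?c = "itinerary_cell M T"
  have Tm: "T \<in> measurable M M" using mp by (simp add: measure_preserving_map_def)
  have fin: "finite ?L" by (rule finite_lists_length_eq[OF partition_props(1)])
  have inj: "inj_on ?c {l\<in>?L. ?c l \<noteq> {}}"
  proof (rule inj_onI)
    fix l l' assume *: "l \<in> {l\<in>?L. ?c l \<noteq> {}}" "l' \<in> {l\<in>?L. ?c l \<noteq> {}}" "?c l = ?c l'"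
    then obtain x where x: "x \<in> ?c l" "x \<in> ?c l'" by auto
    show "l = l'"
    proof (rule nth_equalityI)
      fix i assume i: "i < length l"
      have "(T ^^ i) x \<in> l ! i \<inter> l' ! i" using x * i by (auto simp: itinerary_cell_def)
      moreover have "set l \<subseteq> P" "set l' \<subseteq> P" "i < length l'" using * i by auto
      then have "l ! i \<in> P" "l' ! i \<in> P" using i nth_mem by blast+
      ultimately show "l ! i = l' ! i" using partition_onD2[OF partition_props(3)] unfolding disjoint_def by blast
    qed (use * in auto)
  qed
  have "partition_entropy M (iterated_join M T P n) = - (\<Sum>C\<in>?c ` {l\<in>?L. ?c l \<noteq> {}}. prob C * ln (prob C))"
    unfolding partition_entropy_def iterated_join_eq_itinerary_cells[OF partition_props(3) Tm n]
    by (intro arg_cong[of _ _ uminus] sum.cong) auto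
  also have "\<dots> = - (\<Sum>l\<in>{l\<in>?L. ?c l \<noteq> {}}. prob (?c l) * ln (prob (?c l)))"
    by (subst sum.reindex[OF inj]) simp
  also have "\<dots> = - (\<Sum>l\<in>?L. prob (?c l) * ln (prob (?c l)))"
    by (intro arg_cong[of _ _ uminus] sum.mono_neutral_left) (use fin in auto)
  finally show ?thesis by (simp add: word_entropy_def sum_negf)
qed

lemma word_entropy_nonneg: "0 \<le> word_entropy n"
  unfolding word_entropy_def
proof (rule sum_nonneg)
  fix l
  have "prob C * ln (prob C) \<le> 0" for C
    by (cases "prob C = 0") (auto intro!: mult_nonneg_nonpos simp: measure_nonneg zero_less_measure_iff)
  then show "0 \<le> - (prob (itinerary_cell M T l) * ln (prob (itinerary_cell M T l)))" by simp
qed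

text \<open>
  The conditional entropy of the partition at time \<open>m\<close> given the partition at time \<open>0\<close>.
\<close>

definition return_entropy :: "nat \<Rightarrow> real" where
  "return_entropy m = (\<Sum>z\<in>P. \<Sum>y\<in>P. - (prob (z \<inter> ((T ^^ m) -` y \<inter> space M)) * ln (prob (z \<inter> ((T ^^ m) -` y \<inter> space M)))))
     - (\<Sum>z\<in>P. - (prob z * ln (prob z)))"

lemma sum_prob_cells:
  assumes B: "finite I" "\<And>i. i \<in> I \<Longrightarrow> B i \<in> events" "disjoint_family_on B I" "S = (\<Union>i\<in>I. B i)"
  shows "prob S = (\<Sum>i\<in>I. prob (B i))"
  using B by (simp add: finite_measure_finite_Union image_subset_iff)

text \<open>
  The letter at time \<open>n\<close> is less uncertain given the whole past than given only the letter at time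
  \<open>n - m\<close>, and the latter uncertainty does not depend on \<open>n\<close> because the measure is invariant.
\<close>

lemma word_entropy_increment:
  assumes mn: "1 \<le> m" "m \<le> n"
  shows "word_entropy (Suc n) - word_entropy n \<le> return_entropy m"
proof -
  let ?L = "\<lambda>n. {l. set l \<subseteq> P \<and> length l = n}"
  let ?c = "itinerary_cell M T"
  let ?g = "\<lambda>l :: 'a set list. l ! (n - m)"
  let ?tm = "\<lambda>k A. (T ^^ k) -` A \<inter> space M"
  have fin: "finite (?L k)" for k by (rule finite_lists_length_eq[OF partition_props(1)])
  have Tm: "T \<in> measurable M M" using mp by (simp add: measure_preserving_map_def)
  have PU: "\<Union>P = space M" using partition_props(3) by (simp add: partition_on_def)
  have Pd: "A = B" if "A \<in> P" "B \<in> P" "x \<in> A" "x \<in> B" for A B x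
    using partition_props(3) that by (auto simp: partition_on_def disjoint_def)
  have Tsp: "(T ^^ k) x \<in> space M" if "x \<in> space M" for k x
    using measurable_space[OF meas_pow that] .
  have tmE: "?tm k A \<in> events" if "A \<in> events" for k A
    using measurable_sets[OF meas_pow that] .
  have snoc: "?c (l @ [y]) = ?c l \<inter> ?tm (length l) y" for l y
    by (auto simp: itinerary_cell_def nth_append less_Suc_eq)
  have nm: "n - m < n" using mn by simp
  have gz: "?g l = z" if "l \<in> ?L n" "x \<in> ?c l" "(T ^^ (n - m)) x \<in> z" "z \<in> P" for l x z
  proof (rule Pd)
    show "?g l \<in> P" using that(1) nm nth_mem by blast
    show "(T ^^ (n - m)) x \<in> ?g l" using that(1,2) nm by (simp add: itinerary_cell_def)
  qed (use that in auto)
  have cd: "l = l'" if "x \<in> ?c l" "x \<in> ?c l'" "l \<in> ?L k" "l' \<in> ?L k" for l l' x k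
  proof (rule nth_equalityI)
    fix i assume "i < length l"
    then show "l ! i = l' ! i" using that by (intro Pd[of _ _ "(T^^i) x"]) (auto simp: itinerary_cell_def)
  qed (use that in auto)
  have cover: "\<exists>l \<in> ?L k. x \<in> ?c l" if x: "x \<in> space M" for x k
  proof -
    have "\<forall>i. \<exists>A\<in>P. (T ^^ i) x \<in> A" using Tsp[OF x] PU by blast
    then obtain A where "\<And>i. A i \<in> P \<and> (T ^^ i) x \<in> A i" by metis
    then show ?thesis using x by (intro bexI[of _ "map A [0..<k]"]) (auto simp: itinerary_cell_def)
  qed
  have "(\<Sum>l\<in>?L n. \<Sum>y\<in>P. - (prob (?c (l @ [y])) * ln (prob (?c (l @ [y])))))
      - (\<Sum>l\<in>?L n. - (prob (?c l) * ln (prob (?c l)))) \<le> return_entropy m"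
    unfolding return_entropy_def
  proof (rule entropy_increment_le[where g = ?g])
    show "?g ` ?L n \<subseteq> P" using mn by auto
    show "prob (?c l) = (\<Sum>y\<in>P. prob (?c (l @ [y])))" if l: "l \<in> ?L n" for l
    proof (rule sum_prob_cells)
      show "disjoint_family_on (\<lambda>y. ?c (l @ [y])) P"
        unfolding snoc disjoint_family_on_def using Pd by blast
      show "?c l = (\<Union>y\<in>P. ?c (l @ [y]))"
      proof -
        have "?c l \<subseteq> space M" by (auto simp: itinerary_cell_def)
        then have "\<exists>y\<in>P. (T ^^ length l) x \<in> y" if "x \<in> ?c l" for x
          using Tsp[of x "length l"] PU that by blast
        then show ?thesis unfolding snoc using \<open>?c l \<subseteq> space M\<close> by auto
      qed
    qed (use l partition_props(1,2) in \<open>auto intro!: itinerary_cell_events\<close>)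
    have "prob (?tm (n - m) z \<inter> ?tm n y) = prob (z \<inter> ?tm m y)" if "z \<in> P" "y \<in> P" for z y
    proof -
      have "?tm (n - m) z \<inter> ?tm n y = ?tm (n - m) (z \<inter> ?tm m y)"
      proof -
        have "(T ^^ n) x = (T ^^ m) ((T ^^ (n - m)) x)" for x
          using mn by (metis funpow_add le_add_diff_inverse o_apply)
        then have "x \<in> ?tm n y \<longleftrightarrow> x \<in> ?tm (n - m) (?tm m y)" for x using Tsp[of x "n - m"] by auto
        then show ?thesis by auto
      qed
      moreover have "z \<inter> ?tm m y \<in> events" using that by (intro sets.Int tmE partition_props(2))
      ultimately show ?thesis by (metis measure_preserving_map_iterate(2)[OF mp])
    qed note st = this
    show "prob z = (\<Sum>l\<in>{l\<in>?L n. ?g l = z}. prob (?c l))" if z: "z \<in> P" for z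
    proof -
      have "prob (?tm (n - m) z) = (\<Sum>l\<in>{l\<in>?L n. ?g l = z}. prob (?c l))"
      proof (rule sum_prob_cells)
        show "disjoint_family_on ?c {l\<in>?L n. ?g l = z}"
          unfolding disjoint_family_on_def using cd by blast
        show "?tm (n - m) z = (\<Union>l\<in>{l\<in>?L n. ?g l = z}. ?c l)"
        proof (intro equalityI subsetI)
          fix x assume x: "x \<in> ?tm (n - m) z"
          then obtain l where l: "l \<in> ?L n" "x \<in> ?c l" using cover[of x n] by auto
          then have "?g l = z" using x z gz by blast
          then show "x \<in> (\<Union>l\<in>{l\<in>?L n. ?g l = z}. ?c l)" using l by auto
        next
          fix x assume "x \<in> (\<Union>l\<in>{l\<in>?L n. ?g l = z}. ?c l)"
          then obtain l where "length l = n" "l ! (n - m) = z" "x \<in> ?c l" by blast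
          then show "x \<in> ?tm (n - m) z" using nm by (auto simp only: itinerary_cell_def)
        qed
        show "finite {l\<in>?L n. ?g l = z}" by (rule finite_subset[OF _ fin[of n]]) blast
        show "\<And>l. l \<in> {l\<in>?L n. ?g l = z} \<Longrightarrow> ?c l \<in> events" by (intro itinerary_cell_events) blast
      qed
      then show ?thesis using measure_preserving_map_iterate(2)[OF mp partition_props(2)[OF z]] by metis
    qed
    show "prob (z \<inter> ?tm m y) = (\<Sum>l\<in>{l\<in>?L n. ?g l = z}. prob (?c (l @ [y])))"
      if z: "z \<in> P" and y: "y \<in> P" for z y
      unfolding st[OF z y, symmetric]
    proof (rule sum_prob_cells)
      show "disjoint_family_on (\<lambda>l. ?c (l @ [y])) {l\<in>?L n. ?g l = z}"
        unfolding disjoint_family_on_def snoc using cd by blast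
      show "?tm (n - m) z \<inter> ?tm n y = (\<Union>l\<in>{l\<in>?L n. ?g l = z}. ?c (l @ [y]))"
      proof (intro equalityI subsetI)
        fix x assume x: "x \<in> ?tm (n - m) z \<inter> ?tm n y"
        then obtain l where l: "l \<in> ?L n" "x \<in> ?c l" using cover[of x n] by auto
        then have "?g l = z" using x z gz by blast
        then show "x \<in> (\<Union>l\<in>{l\<in>?L n. ?g l = z}. ?c (l @ [y]))" using l x by (auto simp: snoc)
      next
        fix x assume "x \<in> (\<Union>l\<in>{l\<in>?L n. ?g l = z}. ?c (l @ [y]))"
        then obtain l where "length l = n" "l ! (n - m) = z" "x \<in> ?c l \<inter> ?tm n y"
          unfolding snoc by blast
        then show "x \<in> ?tm (n - m) z \<inter> ?tm n y" using nm by (auto simp only: itinerary_cell_def)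
      qed
      show "finite {l\<in>?L n. ?g l = z}" by (rule finite_subset[OF _ fin[of n]]) blast
      show "\<And>l. l \<in> {l\<in>?L n. ?g l = z} \<Longrightarrow> ?c (l @ [y]) \<in> events"
        using y by (intro itinerary_cell_events) auto
    qed
  qed (rule fin partition_props(1) measure_nonneg)+
  moreover have "word_entropy (Suc n) = (\<Sum>l\<in>?L n. \<Sum>y\<in>P. - (prob (?c (l @ [y])) * ln (prob (?c (l @ [y])))))"
  proof -
    have b: "?L (Suc n) = (\<lambda>(l, y). l @ [y]) ` (?L n \<times> P)"
    proof (intro equalityI subsetI)
      fix l assume "l \<in> ?L (Suc n)"
      then show "l \<in> (\<lambda>(l, y). l @ [y]) ` (?L n \<times> P)"
        by (cases l rule: rev_cases) auto
    qed auto
    have "inj_on (\<lambda>(l, y). l @ [y]) (?L n \<times> P)" by (auto simp: inj_on_def)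
    then have "word_entropy (Suc n)
        = sum ((\<lambda>l. - (prob (?c l) * ln (prob (?c l)))) \<circ> (\<lambda>(l, y). l @ [y])) (?L n \<times> P)"
      unfolding word_entropy_def b by (rule sum.reindex)
    also have "\<dots> = (\<Sum>(l, y)\<in>?L n \<times> P. - (prob (?c (l @ [y])) * ln (prob (?c (l @ [y])))))"
      by (rule sum.cong) (simp_all only: o_apply split_beta)
    finally show ?thesis unfolding sum.cartesian_product .
  qed
  ultimately show ?thesis unfolding word_entropy_def[of n] by linarith
qed

text \<open>
  By the previous lemma the entropy rate is at most \<open>return_entropy m\<close> for every \<open>m \<ge> 1\<close>. Along the
  rigidity times the joint law of two letters tends to the diagonal, and \<open>return_entropy\<close> to \<open>0\<close>.
\<close>

lemma entropy_wrt_partition_rigid: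
  assumes m1: "\<And>k. m k \<ge> (1::nat)"
    and m: "\<And>A. A \<in> sets M \<Longrightarrow> (\<lambda>k. measure M (A \<inter> ((T ^^ m k) -` A \<inter> space M))) \<longlonglongrightarrow> measure M A"
  shows "entropy_wrt_partition M T P = 0"
proof -
  have eta: "(\<lambda>k. - (f k * ln (f k))) \<longlonglongrightarrow> - (x * ln x)" if "f \<longlonglongrightarrow> x" "x \<ge> 0" "\<And>k. f k \<ge> 0" for f :: "nat \<Rightarrow> real" and x
    using continuous_on_tendsto_compose[OF continuous_on_entropy_fun that(1)] that by auto
  have off: "(\<lambda>k. prob (z \<inter> ((T ^^ m k) -` y \<inter> space M))) \<longlonglongrightarrow> (if z = y then prob z else 0)"
    if z: "z \<in> P" and y: "y \<in> P" for z y
  proof (cases "z = y")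
    case True then show ?thesis using m[OF partition_props(2)[OF z]] by simp
  next
    case False
    have d: "z \<inter> y = {}" using False z y partition_props(3) by (auto simp: partition_on_def disjoint_def)
    have te: "(T ^^ k) -` y \<inter> space M \<in> events" for k
      using measurable_sets[OF meas_pow partition_props(2)[OF y]] .
    have "(\<lambda>k. prob y - prob (y \<inter> ((T ^^ m k) -` y \<inter> space M))) \<longlonglongrightarrow> prob y - prob y"
      by (intro tendsto_intros m partition_props y)
    then have lim0: "(\<lambda>k. prob y - prob (y \<inter> ((T ^^ m k) -` y \<inter> space M))) \<longlonglongrightarrow> 0" by simp
    have "prob (z \<inter> ((T ^^ k) -` y \<inter> space M)) \<le> prob y - prob (y \<inter> ((T ^^ k) -` y \<inter> space M))" for k
    proof -
      have "prob (z \<inter> ((T ^^ k) -` y \<inter> space M)) + prob (y \<inter> ((T ^^ k) -` y \<inter> space M))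
         = prob ((z \<inter> ((T ^^ k) -` y \<inter> space M)) \<union> (y \<inter> ((T ^^ k) -` y \<inter> space M)))"
      proof (rule finite_measure_Union[symmetric])
        show "(z \<inter> ((T ^^ k) -` y \<inter> space M)) \<inter> (y \<inter> ((T ^^ k) -` y \<inter> space M)) = {}"
          using d by blast
      qed (intro sets.Int[OF _ te] partition_props(2) z y)+
      also have "\<dots> \<le> prob ((T ^^ k) -` y \<inter> space M)" by (rule finite_measure_mono[OF _ te]) blast
      also have "\<dots> = prob y" using measure_preserving_map_iterate(2)[OF mp partition_props(2)[OF y]] .
      finally show ?thesis by simp
    qed
    then have "(\<lambda>k. prob (z \<inter> ((T ^^ m k) -` y \<inter> space M))) \<longlonglongrightarrow> 0"
      by (intro tendsto_sandwich[OF _ _ tendsto_const lim0]) (auto intro!: always_eventually)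
    then show ?thesis using False by simp
  qed
  have r0: "(\<lambda>k. return_entropy (m k)) \<longlonglongrightarrow> 0"
  proof -
    let ?v = "\<lambda>z y. if z = y then prob z else 0"
    have "(\<lambda>k. return_entropy (m k)) \<longlonglongrightarrow>
       (\<Sum>z\<in>P. \<Sum>y\<in>P. - (?v z y * ln (?v z y))) - (\<Sum>z\<in>P. - (prob z * ln (prob z)))"
      unfolding return_entropy_def
      by (intro tendsto_diff tendsto_sum tendsto_const eta off) auto
    moreover have "(\<Sum>y\<in>P. - (?v z y * ln (?v z y))) = - (prob z * ln (prob z))" if "z \<in> P" for z
    proof -
      have "(\<Sum>y\<in>P. - (?v z y * ln (?v z y))) = (\<Sum>y\<in>P. if y = z then - (prob z * ln (prob z)) else 0)"
        by (intro sum.cong) auto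
      then show ?thesis using that partition_props(1) by simp
    qed
    ultimately show ?thesis by simp
  qed
  have lin: "word_entropy (mm + n) \<le> word_entropy mm + n * return_entropy mm" if "mm \<ge> 1" for mm n
  proof (induction n)
    case (Suc n)
    then show ?case using word_entropy_increment[of mm "mm + n"] that by (simp add: algebra_simps)
  qed simp
  have "(\<lambda>n. word_entropy n / n) \<longlonglongrightarrow> 0"
  proof (rule LIMSEQ_I)
    fix e :: real assume e: "e > 0"
    obtain k where k: "return_entropy (m k) < e / 2"
      using order_tendstoD(2)[OF r0, of "e/2"] e by (auto simp: eventually_sequentially)
    let ?m = "m k"
    have "(\<lambda>n. word_entropy ?m / real n) \<longlonglongrightarrow> 0"
      by (rule lim_const_over_n)
    then obtain N where N: "\<And>n. n \<ge> N \<Longrightarrow> word_entropy ?m / real n < e / 2"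
      using order_tendstoD(2)[of _ 0 sequentially "e/2"] e unfolding eventually_sequentially by (metis half_gt_zero)
    show "\<exists>no. \<forall>n\<ge>no. norm (word_entropy n / n - 0) < e"
    proof (intro exI[of _ "N + ?m"] allI impI)
      fix n assume n: "n \<ge> N + ?m"
      have n0: "n > 0" using n m1[of k] by linarith
      have "word_entropy n \<le> word_entropy ?m + real (n - ?m) * return_entropy ?m"
        using lin[OF m1, of k "n - ?m"] n by simp
      also have "real (n - ?m) * return_entropy ?m \<le> real n * (e / 2)"
      proof -
        have "real (n - ?m) * return_entropy ?m \<le> real (n - ?m) * (e / 2)"
          using k by (intro mult_left_mono) auto
        also have "\<dots> \<le> real n * (e / 2)" using e by (intro mult_right_mono) auto
        finally show ?thesis .
      qed
      finally have "word_entropy n / n \<le> word_entropy ?m / n + e / 2"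
        using n0 by (simp add: field_simps)
      also have "\<dots> < e" using N[OF add_leD1[OF n]] by linarith
      finally show "norm (word_entropy n / n - 0) < e" using word_entropy_nonneg[of n] by simp
    qed
  qed
  then have "(\<lambda>n. partition_entropy M (iterated_join M T P n) / real n) \<longlonglongrightarrow> 0"
    by (rule Lim_transform_eventually)
      (auto simp: eventually_sequentially partition_entropy_iterated_join intro!: exI[of _ 1])
  then show ?thesis unfolding entropy_wrt_partition_def by (rule limI)
qed

end

theorem ks_entropy_rigid:
  assumes "prob_space M" "measure_preserving_map M T" "rigid_map M T"
  shows "ks_entropy M T = 0"
proof -
  interpret prob_space M by fact
  obtain m :: "nat \<Rightarrow> nat" where m: "\<And>k. m k \<ge> 1" "\<And>A. A \<in> sets M \<Longrightarrow>
    (\<lambda>k. measure M (A \<inter> ((T ^^ m k) -` A \<inter> space M))) \<longlonglongrightarrow> measure M A"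
    using assms(3) by (auto simp: rigid_map_def)
  have "finite_measurable_partition M {space M}"
    using not_empty by (auto simp: finite_measurable_partition_def partition_on_def)
  then have ne: "{P. finite_measurable_partition M P} \<noteq> {}" by blast
  have "ks_entropy M T = (SUP P \<in> {P. finite_measurable_partition M P}. 0)"
    unfolding ks_entropy_def
    using entropy_wrt_partition_rigid[OF assms(1,2) _ m] by (intro SUP_cong refl) (simp add: zero_ereal_def)
  then show ?thesis using ne by simp
qed

section \<open>Isomorphic copies and standard spaces\<close>

definition measure_iso :: "'a measure \<Rightarrow> 'b measure \<Rightarrow> ('a \<Rightarrow> 'b) \<Rightarrow> ('b \<Rightarrow> 'a) \<Rightarrow> bool" where
  "measure_iso M N f g \<longleftrightarrow>
     f \<in> measurable M N \<and> g \<in> measurable N M \<and> distr M N f = N \<and>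
     (\<forall>x \<in> space M. g (f x) = x) \<and> (\<forall>y \<in> space N. f (g y) = y)"

context
  fixes M :: "'a measure" and N :: "'b measure" and f g T
  assumes iso: "measure_iso M N f g" and T: "T \<in> measurable M M"
begin

abbreviation conj_map :: "'b \<Rightarrow> 'b" where "conj_map \<equiv> f \<circ> T \<circ> g"

lemma iso_simps:
  "f \<in> measurable M N" "g \<in> measurable N M" "distr M N f = N"
  "x \<in> space M \<Longrightarrow> g (f x) = x" "y \<in> space N \<Longrightarrow> f (g y) = y"
  "x \<in> space M \<Longrightarrow> f x \<in> space N" "y \<in> space N \<Longrightarrow> g y \<in> space M" "x \<in> space M \<Longrightarrow> T x \<in> space M"
  using iso T by (auto simp: measure_iso_def dest: measurable_space)

lemma emeasure_iso: "A \<in> sets N \<Longrightarrow> emeasure N A = emeasure M (f -` A \<inter> space M)"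
  using emeasure_distr[OF iso_simps(1)] iso_simps(3) by metis

lemma measure_iso_vimage: "A \<in> sets N \<Longrightarrow> measure N A = measure M (f -` A \<inter> space M)"
  by (simp add: measure_def emeasure_iso)

lemma conj_map_iterate: "y \<in> space N \<Longrightarrow> (conj_map ^^ n) y = f ((T ^^ n) (g y)) \<and> (T ^^ n) (g y) \<in> space M"
  by (induction n) (auto simp: iso_simps)

lemma conj_map_vimage:
  "f -` ((conj_map ^^ n) -` A \<inter> space N) \<inter> space M = (T ^^ n) -` (f -` A \<inter> space M) \<inter> space M"
proof -
  have "(conj_map ^^ n) (f x) = f ((T ^^ n) x)" "(T ^^ n) x \<in> space M" if "x \<in> space M" for x
    using conj_map_iterate[of "f x" n] that by (auto simp: iso_simps)
  then show ?thesis by (auto simp: iso_simps)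
qed

lemma conj_map_vimage_1:
  "f -` (conj_map -` A \<inter> space N) \<inter> space M = T -` (f -` A \<inter> space M) \<inter> space M"
  by (auto simp: iso_simps)

lemma conj_map_measurable: "conj_map \<in> measurable N N"
  by (intro measurable_comp[OF iso_simps(2)] measurable_comp[OF T iso_simps(1)])

lemma measure_preserving_conj:
  assumes "measure_preserving_map M T"
  shows "measure_preserving_map N conj_map"
  unfolding measure_preserving_map_def
proof (intro conjI ballI conj_map_measurable)
  fix A assume A: "A \<in> sets N"
  have "emeasure N (conj_map -` A \<inter> space N) = emeasure M (T -` (f -` A \<inter> space M) \<inter> space M)"
    using emeasure_iso[OF measurable_sets[OF conj_map_measurable A]] conj_map_vimage_1[of A] by simp
  also have "\<dots> = emeasure M (f -` A \<inter> space M)"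
    using assms measurable_sets[OF iso_simps(1) A] unfolding measure_preserving_map_def by blast
  finally show "emeasure N (conj_map -` A \<inter> space N) = emeasure N A" using emeasure_iso[OF A] by simp
qed

lemma ergodic_conj:
  assumes "ergodic_map M T"
  shows "ergodic_map N conj_map"
  unfolding ergodic_map_def
proof (intro conjI ballI impI)
  show "measure_preserving_map N conj_map"
    using assms by (intro measure_preserving_conj) (simp add: ergodic_map_def)
  fix A assume A: "A \<in> sets N" and inv: "conj_map -` A \<inter> space N = A"
  have "T -` (f -` A \<inter> space M) \<inter> space M = f -` A \<inter> space M"
    using conj_map_vimage_1[of A] unfolding inv by (rule sym)
  then show "measure N A = 0 \<or> measure N A = 1"
    using assms measurable_sets[OF iso_simps(1) A] by (simp add: ergodic_map_def measure_iso_vimage[OF A])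
qed

lemma rigid_conj:
  assumes "rigid_map M T"
  shows "rigid_map N conj_map"
proof -
  obtain m :: "nat \<Rightarrow> nat" where m: "\<And>k. m k \<ge> 1" "\<And>A. A \<in> sets M \<Longrightarrow>
    (\<lambda>k. measure M (A \<inter> ((T ^^ m k) -` A \<inter> space M))) \<longlonglongrightarrow> measure M A"
    using assms by (auto simp: rigid_map_def)
  have "(\<lambda>k. measure N (A \<inter> ((conj_map ^^ m k) -` A \<inter> space N))) \<longlonglongrightarrow> measure N A" if A: "A \<in> sets N" for A
  proof -
    have "conj_map ^^ n \<in> measurable N N" for n
    proof (induction n)
      case (Suc n)
      show ?case unfolding funpow.simps by (rule measurable_comp[OF Suc conj_map_measurable])
    qed (simp add: id_def)
    then have "measure N (A \<inter> ((conj_map ^^ n) -` A \<inter> space N))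
        = measure M ((f -` A \<inter> space M) \<inter> (f -` ((conj_map ^^ n) -` A \<inter> space N) \<inter> space M))" for n
      by (subst measure_iso_vimage) (auto intro!: sets.Int A measurable_sets arg_cong[where f = "measure M"])
    then show ?thesis
      using m(2)[OF measurable_sets[OF iso_simps(1) A]]
      unfolding conj_map_vimage measure_iso_vimage[OF A] by simp
  qed
  then show ?thesis using m(1) by (auto simp: rigid_map_def)
qed

end

text \<open>
  A pair is coded by the set of its graph entries, a subset of a countable set.
\<close>

lemma digits_and_coins_embed_in_reals:
  "\<exists>e :: (nat \<Rightarrow> nat) \<times> (int \<Rightarrow> bool) \<Rightarrow> real. inj e"
proof -
  define c :: "(nat \<Rightarrow> nat) \<times> (int \<Rightarrow> bool) \<Rightarrow> nat set" where
    "c = (\<lambda>(d, x). to_nat ` (range (\<lambda>k. Inl (k, d k)) \<union> Inr ` {i. x i} :: (nat \<times> nat + int) set))"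
  have "inj c"
  proof (rule injI, clarify)
    fix d x d' x' assume "c (d, x) = c (d', x')"
    then have *: "(range (\<lambda>k. Inl (k, d k)) \<union> Inr ` {i. x i} :: (nat \<times> nat + int) set)
       = range (\<lambda>k. Inl (k, d' k)) \<union> Inr ` {i. x' i}"
      unfolding c_def by (simp add: inj_image_eq_iff del: image_Un)
    have "d k = d' k" for k
    proof -
      have "Inl (k, d k) \<in> (range (\<lambda>k. Inl (k, d' k)) \<union> Inr ` {i. x' i} :: (nat \<times> nat + int) set)"
        unfolding *[symmetric] by blast
      then show ?thesis by auto
    qed
    moreover have "x i \<longleftrightarrow> x' i" for i
      using * by (auto simp: set_eq_iff dest!: spec[of _ "Inr i"])
    ultimately show "d = d' \<and> x = x'" by auto
  qed
  moreover obtain b :: "nat set \<Rightarrow> real" where "inj b"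
    using nat_sets_eqpoll_reals unfolding eqpoll_def bij_betw_def by blast
  ultimately show ?thesis using inj_compose by blast
qed

lemma completely_metrizable_euclidean_fun:
  "completely_metrizable_space (euclidean :: ('i::countable \<Rightarrow> 'a::discrete_topology) topology)"
proof -
  have "(euclidean :: ('i \<Rightarrow> 'a) topology) = product_topology (\<lambda>_. discrete_topology UNIV) UNIV"
  proof -
    have "discrete_topology UNIV = (euclidean :: 'a topology)"
      by (auto simp: topology_eq intro: discrete_topology_class.open_discrete)
    then show ?thesis by (simp add: euclidean_product_topology)
  qed
  then show ?thesis
    by (simp add: completely_metrizable_space_product_topology completely_metrizable_space_discrete_topology)
qed

text \<open>
  The topology that witnesses standardness is the one that makes the injection \<open>e\<close> a homeomorphism
  onto its range; it is unrelated to the topology of the target type.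
\<close>

lemma standard_embed_measure:
  fixes e :: "'a::second_countable_topology \<Rightarrow> 'b"
  assumes prob: "prob_space M" and sets: "sets M = sets borel" and e: "inj e"
    and cm: "completely_metrizable_space (euclidean :: 'a topology)"
  shows "standard_probability_space (embed_measure M e)"
    and "measure_iso M (embed_measure M e) e (the_inv e)"
proof -
  let ?N = "embed_measure M e"
  have sp: "space M = UNIV" using sets_eq_imp_space_eq[OF sets] by simp
  have e1: "e \<in> measurable M ?N" using e by (intro measurable_embed_measure2)
  have d: "distr M ?N e = ?N" using embed_measure_eq_distr[OF e, of M] by simp
  have spN: "space ?N = range e" by (simp add: space_embed_measure sp)
  have setsN: "sets ?N = {e ` A |A. A \<in> sets M}" using e by (intro sets_embed_measure) 
  show "measure_iso M ?N e (the_inv e)"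
    unfolding measure_iso_def
  proof (intro conjI e1 d measurableI ballI)
    fix A assume A: "A \<in> sets M"
    have "the_inv e -` A \<inter> space ?N = e ` A" using e by (auto simp: spN the_inv_f_f)
    then show "the_inv e -` A \<inter> space ?N \<in> sets ?N" using A setsN by blast
  qed (use e in \<open>auto simp: sp spN the_inv_f_f\<close>)
  let ?t = "pullback_topology (range e) (the_inv e) (euclidean :: 'a topology)"
  have ts: "topspace ?t = range e" by (simp add: topspace_pullback_topology)
  have op: "openin ?t S \<longleftrightarrow> (\<exists>U. open U \<and> S = e ` U)" for S
  proof -
    have "the_inv e -` U \<inter> range e = e ` U" for U using e by (auto simp: the_inv_f_f)
    then show ?thesis by (simp add: openin_pullback_topology)
  qed
  have "homeomorphic_map euclidean ?t e"
  proof (rule bijective_open_imp_homeomorphic_map)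
    show "continuous_map euclidean ?t e"
    proof (rule continuous_map_pullback')
      have "the_inv e \<circ> e = id" using e by (auto simp: the_inv_f_f)
      then show "continuous_map euclidean euclidean (the_inv e \<circ> e)" by simp
    qed auto
    show "open_map euclidean ?t e" by (auto simp: open_map_def op)
  qed (use e ts in auto)
  then have hom: "(euclidean :: 'a topology) homeomorphic_space ?t"
    using homeomorphic_map_imp_homeomorphic_space by blast
  have "sets ?N = sigma_sets (range e) {U. openin ?t U}"
  proof -
    have "sets ?N = (\<lambda>A. the_inv e -` A \<inter> range e) ` sets M"
    proof -
      have "the_inv e -` U \<inter> range e = e ` U" for U using e by (auto simp: the_inv_f_f)
      then show ?thesis unfolding setsN by auto
    qed
    also have "\<dots> = (\<lambda>A. the_inv e -` A \<inter> range e) ` sigma_sets UNIV {U. open U}"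
      by (simp add: sets borel_def)
    also have "\<dots> = sigma_sets (range e) {the_inv e -` A \<inter> range e |A. A \<in> {U. open U}}"
      using sigma_sets_vimage_commute[of "the_inv e" "range e" UNIV "{U. open U}"]
      by (simp add: Setcompr_eq_image)
    also have "{the_inv e -` A \<inter> range e |A. A \<in> {U. open U}} = {U. openin ?t U}"
      by (auto simp: openin_pullback_topology)
    finally show ?thesis .
  qed
  moreover have "prob_space ?N" using prob_space.prob_space_distr[OF prob e1] d by simp
  moreover have "completely_metrizable_space ?t" 
    using homeomorphic_completely_metrizable_space[OF hom] cm by simp
  moreover have "second_countable ?t" 
  proof -
    have "second_countable (euclidean :: 'a topology)"
    proof -
      obtain B :: "'a set set" where B: "countable B" "\<And>C. C \<in> B \<Longrightarrow> open C"
        "\<And>S. open S \<Longrightarrow> \<exists>U. U \<subseteq> B \<and> S = \<Union>U"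
        using univ_second_countable by blast
      have "\<exists>V\<in>B. x \<in> V \<and> V \<subseteq> U" if "open U" "x \<in> U" for U x
        using B(3)[OF that(1)] that(2) by blast
      with B show ?thesis unfolding second_countable_def by (intro exI[of _ B]) auto
    qed
    then show ?thesis using homeomorphic_space_second_countability[OF hom] by simp
  qed
  ultimately show "standard_probability_space ?N"
    unfolding standard_probability_space_def by (auto simp: spN intro!: exI[of _ ?t] simp: ts)
qed

section \<open>Approximation by algebras, and skew products\<close>

text \<open>
  The approximable sets are closed under complements and, because the measure is finite, under
  countable unions: a finite subunion carries all but \<open>e / 2\<close> of the measure, and its members are
  approximated individually.
\<close>

lemma (in finite_measure) approximation_by_algebra:
  assumes alg: "algebra (space M) \<A>" and gen: "sets M = sigma_sets (space M) \<A>"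
    and A: "A \<in> sets M" and e: "e > 0"
  shows "\<exists>C\<in>\<A>. measure M ((A - C) \<union> (C - A)) < e"
proof -
  interpret algebra "space M" \<A> by (rule alg)
  have sub: "\<A> \<subseteq> sets M" unfolding gen by (auto intro: sigma_sets.Basic)
  have "A \<in> sigma_sets (space M) \<A>" using A gen by simp
  then show ?thesis using e
  proof (induction arbitrary: e)
    case (Basic a)
    then show ?case by (intro bexI[of _ a]) auto
  next
    case Empty
    then show ?case by (intro bexI[of _ "{}"]) auto
  next
    case (Compl a)
    then obtain C where C: "C \<in> \<A>" "measure M ((a - C) \<union> (C - a)) < e" by blast
    have "C \<subseteq> space M" using C(1) sub sets.sets_into_space by blast
    moreover have "a \<subseteq> space M" using Compl(1) gen sets.sets_into_space by blast
    ultimately have "((space M - a) - (space M - C)) \<union> ((space M - C) - (space M - a)) = (a - C) \<union> (C - a)"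
      by blast
    then show ?case using C by (intro bexI[of _ "space M - C"]) auto
  next
    case (Union a)
    have am: "a i \<in> sets M" for i using Union(1) gen by simp
    define U where "U = (\<Union>i. a i)"
    have Um: "U \<in> sets M" using am by (auto simp: U_def)
    have "(\<lambda>n. measure M (\<Union>i<n. a i)) \<longlonglongrightarrow> measure M (\<Union>n. \<Union>i<n. a i)"
      by (rule finite_Lim_measure_incseq) (use am in \<open>auto simp: incseq_def intro: less_le_trans\<close>)
    moreover have "(\<Union>n. \<Union>i<n. a i) = U" by (auto simp: U_def)
    ultimately have "\<forall>\<^sub>F n in sequentially. measure M U - e / 2 < measure M (\<Union>i<n. a i)"
      using Union(3) by (intro order_tendstoD(1)) auto
    then obtain n where n: "measure M U - e / 2 < measure M (\<Union>i<n. a i)"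
      by (auto simp: eventually_sequentially)
    define d where "d = e / (2 * (real n + 1))"
    have d: "d > 0" using Union(3) by (simp add: d_def)
    from Union(2)[OF d] obtain C where C: "\<And>i. C i \<in> \<A>" "\<And>i. measure M ((a i - C i) \<union> (C i - a i)) < d"
      by metis
    define D where "D = (\<Union>i<n. C i)"
    have DA: "D \<in> \<A>" using C(1) by (auto simp: D_def)
    have Cm: "C i \<in> sets M" for i using C(1) sub by blast
    let ?Un = "\<Union>i<n. a i"
    have "measure M ((U - D) \<union> (D - U)) \<le> measure M ((U - ?Un) \<union> (\<Union>i<n. (a i - C i) \<union> (C i - a i)))"
      by (rule finite_measure_mono) (use am Cm Um in \<open>auto simp: D_def U_def\<close>)
    also have "\<dots> \<le> measure M (U - ?Un) + measure M (\<Union>i<n. (a i - C i) \<union> (C i - a i))"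
      by (rule measure_Un_le) (use am Cm Um in auto)
    also have "measure M (U - ?Un) = measure M U - measure M ?Un"
      using am Um by (intro finite_measure_Diff) (auto simp: U_def)
    also have "measure M (\<Union>i<n. (a i - C i) \<union> (C i - a i)) \<le> (\<Sum>i<n. measure M ((a i - C i) \<union> (C i - a i)))"
      using am Cm by (intro finite_measure_subadditive_finite) auto
    also have "\<dots> \<le> (\<Sum>i<n. d)" using C(2) by (intro sum_mono less_imp_le) auto
    also have "\<dots> \<le> e / 2" using Union(3) by (simp add: d_def field_simps)
    finally have "measure M ((U - D) \<union> (D - U)) < e" using n by linarith
    then show ?case using DA by (intro bexI[of _ D]) (auto simp: U_def)
  qed
qed

lemma distr_skew_product:
  assumes "prob_space MY" "prob_space MX"
  assumes f: "f \<in> measurable MY MY" "distr MY MY f = MY"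
    and g: "\<And>y. y \<in> space MY \<Longrightarrow> distr MX MX (g y) = MX" "(\<lambda>(y, x). g y x) \<in> measurable (MY \<Otimes>\<^sub>M MX) MX"
  shows "(\<lambda>(y, x). (f y, g y x)) \<in> measurable (MY \<Otimes>\<^sub>M MX) (MY \<Otimes>\<^sub>M MX)" (is ?m)
    and "distr (MY \<Otimes>\<^sub>M MX) (MY \<Otimes>\<^sub>M MX) (\<lambda>(y, x). (f y, g y x)) = MY \<Otimes>\<^sub>M MX"
proof -
  interpret Y: prob_space MY by fact
  interpret X: prob_space MX by fact
  note f(1)[measurable] g(2)[measurable]
  have g': "(\<lambda>p. g (fst p) (snd p)) \<in> measurable (MY \<Otimes>\<^sub>M MX) MX" using g(2) by (simp add: split_def)
  show m: ?m unfolding split_def using g' by measurable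
  have gy: "g y \<in> measurable MX MX" if "y \<in> space MY" for y
    using measurable_compose[OF measurable_Pair1'[OF that] g(2)] by simp
  show "distr (MY \<Otimes>\<^sub>M MX) (MY \<Otimes>\<^sub>M MX) (\<lambda>(y, x). (f y, g y x)) = MY \<Otimes>\<^sub>M MX"
  proof (rule measure_eqI)
    fix A assume "A \<in> sets (distr (MY \<Otimes>\<^sub>M MX) (MY \<Otimes>\<^sub>M MX) (\<lambda>(y, x). (f y, g y x)))"
    then have A[measurable]: "A \<in> sets (MY \<Otimes>\<^sub>M MX)" by simp
    let ?F = "\<lambda>(y, x). (f y, g y x)"
    have fib: "emeasure MX (Pair y -` (?F -` A \<inter> space (MY \<Otimes>\<^sub>M MX))) = emeasure MX (Pair (f y) -` A)"
      if y: "y \<in> space MY" for y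
    proof -
      have "Pair y -` (?F -` A \<inter> space (MY \<Otimes>\<^sub>M MX)) = g y -` (Pair (f y) -` A) \<inter> space MX"
        using y by (auto simp: space_pair_measure)
      then have "emeasure MX (Pair y -` (?F -` A \<inter> space (MY \<Otimes>\<^sub>M MX))) = emeasure (distr MX MX (g y)) (Pair (f y) -` A)"
        using gy[OF y] sets_Pair1[OF A] by (simp add: emeasure_distr)
      then show ?thesis using g(1)[OF y] by simp
    qed
    have "emeasure (distr (MY \<Otimes>\<^sub>M MX) (MY \<Otimes>\<^sub>M MX) ?F) A = emeasure (MY \<Otimes>\<^sub>M MX) (?F -` A \<inter> space (MY \<Otimes>\<^sub>M MX))"
      using m A by (rule emeasure_distr)
    also have "\<dots> = (\<integral>\<^sup>+y. emeasure MX (Pair y -` (?F -` A \<inter> space (MY \<Otimes>\<^sub>M MX))) \<partial>MY)"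
      by (rule X.emeasure_pair_measure_alt[OF measurable_sets[OF m A]])
    also have "\<dots> = (\<integral>\<^sup>+y. emeasure MX (Pair (f y) -` A) \<partial>MY)"
      by (rule nn_integral_cong[OF fib])
    also have "\<dots> = (\<integral>\<^sup>+y. emeasure MX (Pair y -` A) \<partial>distr MY MY f)"
      using X.measurable_emeasure_Pair[OF A] by (subst nn_integral_distr) (auto intro: f)
    also have "\<dots> = emeasure (MY \<Otimes>\<^sub>M MX) A"
      unfolding f(2) by (rule X.emeasure_pair_measure_alt[OF A, symmetric])
    finally show "emeasure (distr (MY \<Otimes>\<^sub>M MX) (MY \<Otimes>\<^sub>M MX) ?F) A = emeasure (MY \<Otimes>\<^sub>M MX) A" .
  qed simp
qed

section \<open>Arithmetic of the odometer\<close>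

text \<open>
  The bound \<open>4\<close> is what \<open>mix_displacement\<close> needs: adding \<open>2\<close> modulo \<open>q k\<close> must change a residue by at
  least \<open>2\<close> in both directions.
\<close>

locale odometer =
  fixes q :: "nat \<Rightarrow> nat"
  assumes q_ge_4: "q k \<ge> 4"
begin

text \<open>
  Digit \<open>k\<close> runs through the residues modulo \<open>q k\<close> exactly \<open>k + 2\<close> times. The position \<open>position K d\<close> is
  the number with digits \<open>d 0, \<dots>, d (K - 1)\<close>, and \<open>site K d\<close> is where the observer stands, as far as the
  first \<open>K\<close> digits can tell. Digits are reduced modulo \<open>r\<close> so that all these notions make sense for
  arbitrary sequences, including the null set of those that are out of range.
\<close>

definition r :: "nat \<Rightarrow> nat" where "r k = (k + 2) * q k"
definition h :: "nat \<Rightarrow> nat" where "h k = (\<Prod>j<k. r j)"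
definition sites :: "nat \<Rightarrow> nat" where "sites k = (\<Prod>j<k. q j)"
definition digit :: "nat \<Rightarrow> nat \<Rightarrow> nat" where "digit k v = (v div h k) mod r k"
definition position :: "nat \<Rightarrow> (nat \<Rightarrow> nat) \<Rightarrow> nat" where "position K d = (\<Sum>j<K. (d j mod r j) * h j)"
definition site :: "nat \<Rightarrow> (nat \<Rightarrow> nat) \<Rightarrow> int" where "site K d = (\<Sum>j<K. int ((d j mod q j) * sites j))"
definition add :: "nat \<Rightarrow> (nat \<Rightarrow> nat) \<Rightarrow> nat \<Rightarrow> nat" where "add n d = (\<lambda>k. digit k (position (Suc k) d + n))"
text \<open>
  The point at position \<open>w\<close> in the level-\<open>K\<close> block of \<open>d\<close>.
\<close>

definition replace :: "nat \<Rightarrow> nat \<Rightarrow> (nat \<Rightarrow> nat) \<Rightarrow> nat \<Rightarrow> nat" where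
  "replace K w d = (\<lambda>i. if i < K then digit i w else d i mod r i)"

lemma q_pos [simp]: "q k > 0" using q_ge_4[of k] by simp
lemma r_pos [simp]: "r k > 0" by (simp add: r_def)
lemma h_pos [simp]: "h k > 0" by (simp add: h_def prod_pos)
lemma h_0 [simp]: "h 0 = 1" by (simp add: h_def)
lemma h_Suc: "h (Suc k) = h k * r k" by (simp add: h_def mult.commute)
lemma sites_pos [simp]: "sites k > 0" by (simp add: sites_def prod_pos)
lemma sites_0 [simp]: "sites 0 = 1" by (simp add: sites_def)
lemma sites_Suc: "sites (Suc k) = sites k * q k" by (simp add: sites_def mult.commute)
lemma position_0 [simp]: "position 0 d = 0" by (simp add: position_def)
lemma position_Suc: "position (Suc K) d = position K d + (d K mod r K) * h K" by (simp add: position_def)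
lemma site_0 [simp]: "site 0 d = 0" by (simp add: site_def)
lemma site_Suc: "site (Suc K) d = site K d + int ((d K mod q K) * sites K)" by (simp add: site_def)

lemma mod_r_mod_q [simp]: "(a mod r k) mod q k = a mod q k"
  by (rule mod_mod_cancel) (simp add: r_def)

lemma h_dvd: "j \<le> k \<Longrightarrow> h j dvd h k"
  by (induction k rule: dec_induct) (auto simp: h_Suc)

lemma h_ge: "2 ^ k \<le> h k"
proof (induction k)
  case (Suc k)
  have "2 \<le> r k" using q_ge_4[of k] by (simp add: r_def)
  then have "2 ^ k * 2 \<le> h k * r k" using Suc by (intro mult_mono) auto
  then show ?case by (simp add: h_Suc mult.commute)
qed simp

lemma sites_ge: "k < sites k"
proof (induction k)
  case (Suc k)
  have "sites k * 4 \<le> sites k * q k" using q_ge_4 by (intro mult_left_mono) auto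
  then show ?case using Suc unfolding sites_Suc by linarith
qed simp

lemma position_less: "position K d < h K"
proof (induction K)
  case (Suc K)
  have "d K mod r K + 1 \<le> r K" by (simp add: Suc_leI)
  then have "(d K mod r K + 1) * h K \<le> r K * h K" by (rule mult_right_mono) simp
  then show ?case using Suc by (simp add: position_Suc h_Suc mult.commute)
qed simp

lemma position_mod: "K \<le> J \<Longrightarrow> position J d mod h K = position K d"
proof (induction J rule: dec_induct)
  case base show ?case by (simp add: position_less)
next
  case (step n)
  have "(d n mod r n * h n) mod h K = 0" using h_dvd[OF step(1)] by simp
  then have "(position n d + d n mod r n * h n) mod h K = position n d mod h K" by (metis add.right_neutral mod_add_right_eq)
  then show ?case using step by (simp add: position_Suc)
qed

lemma position_cong: "(\<And>j. j < K \<Longrightarrow> d j mod r j = d' j mod r j) \<Longrightarrow> position K d = position K d'"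
  by (simp add: position_def)

lemma site_cong: "(\<And>j. j < K \<Longrightarrow> d j mod q j = d' j mod q j) \<Longrightarrow> site K d = site K d'"
  by (simp add: site_def)

lemma digit_less [simp]: "digit k v < r k" by (simp add: digit_def)

lemma digit_mod: "k < K \<Longrightarrow> digit k (v mod h K) = digit k v"
proof -
  assume "k < K"
  then have "h (Suc k) dvd h K" by (intro h_dvd) simp
  then have "v mod h K mod (h k * r k) = v mod (h k * r k)"
    by (simp add: mod_mod_cancel h_Suc)
  moreover have "digit k w = (w mod (h k * r k)) div h k" for w
    by (simp add: digit_def mod_mult2_eq)
  ultimately show ?thesis by simp
qed

lemma digit_position: "j < K \<Longrightarrow> digit j (position K d) = d j mod r j"
proof -
  assume j: "j < K"
  have "digit j (position K d) = digit j (position K d mod h (Suc j))" by (simp add: digit_mod)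
  also have "position K d mod h (Suc j) = position (Suc j) d" using j by (intro position_mod) simp
  also have "digit j (position (Suc j) d) = d j mod r j"
    using position_less[of j d] by (simp add: position_Suc digit_def)
  finally show ?thesis .
qed

lemma position_digit: "position K (\<lambda>j. digit j v) = v mod h K"
  by (induction K) (simp_all add: position_Suc h_Suc mod_mult2_eq digit_def mult.commute)

lemma position_add: "position K (add n d) = (position K d + n) mod h K"
proof -
  have "position K (add n d) = position K (\<lambda>j. digit j (position K d + n))"
  proof (rule position_cong)
    fix j assume j: "j < K"
    have "(position (Suc j) d + n) mod h (Suc j) = (position K d + n) mod h (Suc j)"
      using j by (metis position_mod Suc_leI mod_add_left_eq)
    then have "digit j (position (Suc j) d + n) = digit j (position K d + n)"
      by (metis digit_mod lessI)
    then show "add n d j mod r j = digit j (position K d + n) mod r j" by (simp add: add_def)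
  qed
  then show ?thesis by (simp add: position_digit)
qed

lemma add_add: "add m (add n d) = add (n + m) d"
proof
  fix k
  have "add m (add n d) k = digit k ((position (Suc k) d + n) mod h (Suc k) + m)"
    unfolding position_add[symmetric] by (simp add: add_def)
  also have "\<dots> = digit k (((position (Suc k) d + n) mod h (Suc k) + m) mod h (Suc k))" by (simp add: digit_mod)
  also have "\<dots> = digit k (position (Suc k) d + (n + m))" by (simp add: mod_add_left_eq digit_mod add.assoc)
  finally show "add m (add n d) k = add (n + m) d k" by (simp add: add_def)
qed

lemma position_add_less:
  assumes "position K d + n < h K" "K \<le> J"
  shows "position J d + n < h J"
  using assms(2,1)
proof (induction J rule: dec_induct)
  case (step J)
  have "d J mod r J + 1 \<le> r J" by (simp add: Suc_leI)
  then have "(d J mod r J + 1) * h J \<le> r J * h J" by (rule mult_right_mono) simp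
  then show ?case using step by (simp add: position_Suc h_Suc mult.commute)
qed

lemma add_eq_replace:
  assumes "position K d + n < h K"
  shows "add n d = replace K (position K d + n) d"
proof
  fix i
  show "add n d i = replace K (position K d + n) d i"
  proof (cases "i < K")
    case True
    have "(position (Suc i) d + n) mod h (Suc i) = (position K d + n) mod h (Suc i)"
      using True by (metis position_mod Suc_leI mod_add_left_eq)
    then have "digit i (position (Suc i) d + n) = digit i (position K d + n)" by (metis digit_mod lessI)
    then show ?thesis using True by (simp add: add_def replace_def)
  next
    case False
    then have small: "position i d + n < h i" using position_add_less[OF assms, of i] by simp
    have split: "position (Suc i) d + n = (position i d + n) + (d i mod r i) * h i" by (simp only: position_Suc ac_simps)
    have "(x + a * h i) div h i = a" if "x < h i" for x a using that by simp
    then have "digit i (position (Suc i) d + n) = d i mod r i" unfolding digit_def split using small by simp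
    then show ?thesis using False by (simp add: add_def replace_def)
  qed
qed

lemma position_replace:
  assumes "w < h K" "K \<le> J"
  shows "position J (replace K w d) = w + (position J d - position K d)"
  using assms(2,1)
proof (induction J rule: dec_induct)
  case base
  have "position K (replace K w d) = position K (\<lambda>j. digit j w)" by (rule position_cong) (simp add: replace_def)
  then show ?case using base by (simp add: position_digit)
next
  case (step J)
  have "position K d \<le> position J d" using position_mod[OF step(1), of d] by (metis mod_less_eq_dividend)
  then show ?case using step by (simp add: position_Suc replace_def)
qed

lemma replace_position: "(\<And>k. d k < r k) \<Longrightarrow> replace K (position K d) d = d"
  by (auto simp: replace_def digit_position fun_eq_iff)

lemma replace_replace: "replace K w (replace K v d) = replace K w d"
  by (auto simp: replace_def)

lemma site_nonneg: "0 \<le> site K d" by (simp add: site_def sum_nonneg)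

lemma site_less: "site K d < int (sites K)"
proof (induction K)
  case (Suc K)
  have "d K mod q K + 1 \<le> q K" by (simp add: Suc_leI)
  then have "(d K mod q K + 1) * sites K \<le> q K * sites K" by (rule mult_right_mono) simp
  then have "int ((d K mod q K) * sites K) + int (sites K) \<le> int (sites (Suc K))"
    unfolding of_nat_add[symmetric] of_nat_le_iff by (simp add: sites_Suc mult.commute)
  then show ?case using Suc by (simp add: site_Suc)
qed simp

lemma site_eq_Suc:
  assumes "site (Suc K) d = site (Suc K) d'"
  shows "site K d = site K d'" "d K mod q K = d' K mod q K"
proof -
  let ?z = "int (d K mod q K)" and ?z' = "int (d' K mod q K)"
  have "site (Suc K) d mod int (sites K) = site K d" "site (Suc K) d' mod int (sites K) = site K d'"
    using site_nonneg[of K] site_less[of K] by (simp_all add: site_Suc)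
  then show 1: "site K d = site K d'" using assms by simp
  then have "int ((d K mod q K) * sites K) = int ((d' K mod q K) * sites K)" using assms unfolding site_Suc by linarith
  then show "d K mod q K = d' K mod q K" unfolding of_nat_eq_iff using sites_pos[of K] by (metis mult_right_cancel less_irrefl)
qed

text \<open>
  No element of \<open>S\<close> is within distance less than \<open>h k\<close> of a multiple \<open>j * q k * h k\<close> with \<open>1 \<le> j < k + 2\<close>,
  where \<open>h k\<close> bounds what the digits below \<open>k\<close> can contribute to a time difference.
\<close>

definition spread :: "nat set \<Rightarrow> bool" where
  "spread S \<longleftrightarrow> (\<forall>k. \<forall>j\<in>{1..<k+2}. \<forall>a\<in>S. int (h k) \<le> \<bar>int a - int (j * (q k * h k))\<bar>)"

text \<open>
  Two points of one block at the same site have digits that agree modulo \<open>q\<close>, so their positions differ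
  by a sum of terms \<open>j * q k * h k\<close> with \<open>\<bar>j\<bar> < k + 2\<close>. The topmost nonzero term dominates: if it is
  negative, so is the difference; if it is positive, \<open>spread\<close> applies.
\<close>

lemma no_return:
  assumes S: "spread S" "a \<in> S" "a > 0"
    and site: "site K d = site K d'"
  shows "int (position K d') - int (position K d) \<noteq> int a"
  using site
proof (induction K)
  case (Suc K)
  note U' = site_eq_Suc[OF Suc.prems]
  let ?e = "d K mod r K" and ?e' = "d' K mod r K"
  define b where "b = ?e div q K"
  define b' where "b' = ?e' div q K"
  define z where "z = d K mod q K"
  have e: "?e = b * q K + z" unfolding b_def z_def
    by (metis div_mult_mod_eq mod_r_mod_q)
  have e': "?e' = b' * q K + z" unfolding b'_def z_def U'(2)
    by (metis div_mult_mod_eq mod_r_mod_q)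
  have "?e < (K + 2) * q K" "?e' < (K + 2) * q K" by (simp_all add: r_def)
  then have b: "b < K + 2" "b' < K + 2"
    by (simp_all add: b_def b'_def less_mult_imp_div_less)
  let ?j = "int b' - int b"
  have diff: "int (position (Suc K) d') - int (position (Suc K) d) = (int (position K d') - int (position K d)) + ?j * int (q K * h K)"
    unfolding position_Suc e e' by (simp add: algebra_simps)
  have small: "\<bar>int (position K d') - int (position K d)\<bar> < int (h K)"
    using position_less[of K d] position_less[of K d'] by linarith
  show ?case
  proof
    assume eq: "int (position (Suc K) d') - int (position (Suc K) d) = int a"
    consider "?j = 0" | "?j < 0" | "?j > 0" by linarith
    then show False
    proof cases
      case 1
      then show False using Suc.IH[OF U'(1)] eq diff by simp
    next
      case 2
      have "1 * h K \<le> q K * h K" using q_ge_4[of K] by (intro mult_right_mono) auto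
      moreover have "?j * int (q K * h K) \<le> (-1) * int (q K * h K)" using 2 by (intro mult_right_mono) auto
      ultimately show False using eq diff small by linarith
    next
      case 3
      define j where "j = b' - b"
      have j: "j \<in> {1..<K+2}" "?j = int j" using 3 b by (auto simp: j_def)
      then have "int (h K) \<le> \<bar>int a - int (j * (q K * h K))\<bar>" using S by (auto simp: spread_def)
      moreover have "int a - int (j * (q K * h K)) = int (position K d') - int (position K d)"
        using eq diff j by simp
      ultimately show False using small by simp
    qed
  qed
qed (use assms in simp)

end

text \<open>
  Counting: only the even candidates \<open>t = 2 * u\<close> are considered, since then two distinct \<open>u\<close> cannot both
  be spoiled by the same pair \<open>(j, n)\<close>. A spoiled \<open>u\<close> below \<open>b\<^sup>2\<close> comes from an \<open>n\<close> of order at most \<open>b\<close>, by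
  \<open>a n \<ge> n\<^sup>2\<close>, so there are fewer pairs than candidates once \<open>b\<close> is large.
\<close>

lemma sparse_multiple_exists:
  fixes a :: "nat \<Rightarrow> nat"
  assumes a: "\<And>n. n \<ge> 1 \<Longrightarrow> n ^ 2 \<le> a n" and h: "h \<ge> 1" and s: "s \<ge> 1"
  shows "\<exists>t\<ge>4. \<forall>j\<in>{1..<s}. \<forall>n\<ge>1. int h \<le> \<bar>int (a n) - int (j * (t * h))\<bar>"
proof (rule ccontr)
  assume neg: "\<not> ?thesis"
  \<comment> \<open>there are \<open>b\<^sup>2\<close> candidates \<open>u\<close>, and every \<open>n\<close> that spoils one of them is at most \<open>c\<close>\<close>
  define b where "b = 8 * h * s ^ 2"
  define c where "c = 7 * h * s * b"
  have "\<forall>u. \<exists>j n. u \<ge> 2 \<longrightarrow> j \<in> {1..<s} \<and> n \<ge> 1 \<and> \<bar>int (a n) - int (j * (2 * u * h))\<bar> < int h"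
  proof
    fix u :: nat
    have "u \<ge> 2 \<Longrightarrow> 2 * u \<ge> 4" by simp
    then show "\<exists>j n. u \<ge> 2 \<longrightarrow> j \<in> {1..<s} \<and> n \<ge> 1 \<and> \<bar>int (a n) - int (j * (2 * u * h))\<bar> < int h"
      using neg by (metis not_le)
  qed
  then obtain J n where Jn: "\<And>u. u \<ge> 2 \<Longrightarrow> J u \<in> {1..<s}" "\<And>u. u \<ge> 2 \<Longrightarrow> n u \<ge> 1"
    "\<And>u. u \<ge> 2 \<Longrightarrow> \<bar>int (a (n u)) - int (J u * (2 * u * h))\<bar> < int h"
    by metis
  let ?I = "{2..<2 + b ^ 2}"
  have b1: "b \<ge> 1" using h s by (simp add: b_def)
  have nle: "n u \<le> c" if u: "u \<in> ?I" for u
  proof -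
    have "int (a (n u)) < int (J u * (2 * u * h)) + int h" using Jn(3)[of u] u unfolding atLeastLessThan_iff by linarith
    then have "a (n u) < J u * (2 * u * h) + h" by linarith
    also have "\<dots> \<le> s * (2 * (2 + b ^ 2) * h) + h"
      using Jn(1)[of u] u by (intro add_mono mult_mono) auto
    also have "\<dots> = 4 * (s * h) * 1 + 2 * (s * h) * b ^ 2 + h * 1" by (simp add: algebra_simps)
    also have "\<dots> \<le> 4 * (s * h) * b ^ 2 + 2 * (s * h) * b ^ 2 + (s * h) * b ^ 2"
      using b1 s by (intro add_mono mult_mono) auto
    also have "\<dots> = 7 * (s * h) * b ^ 2" by simp
    also have "\<dots> \<le> (7 * (s * h)) ^ 2 * b ^ 2" using h s by (intro mult_right_mono) (auto simp: power2_eq_square)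
    also have "\<dots> = c ^ 2" by (simp add: c_def power_mult_distrib algebra_simps power2_eq_square)
    finally have "(n u) ^ 2 < c ^ 2" using a[OF Jn(2)[of u]] u by auto
    then have "n u < c" by (rule power_less_imp_less_base) simp
    then show ?thesis by simp
  qed
  have inj: "inj_on (\<lambda>u. (J u, n u)) ?I"
  proof (rule inj_onI)
    fix u v assume u: "u \<in> ?I" and v: "v \<in> ?I" and eq: "(J u, n u) = (J v, n v)"
    have "\<bar>int (J u * (2 * u * h)) - int (J u * (2 * v * h))\<bar> < 2 * int h"
      using Jn(3)[of u] Jn(3)[of v] u v eq by auto
    moreover have "int (J u * (2 * u * h)) - int (J u * (2 * v * h)) = 2 * int h * (int (J u) * (int u - int v))"
      by (simp add: algebra_simps)
    ultimately have "\<bar>2 * int h * (int (J u) * (int u - int v))\<bar> < 2 * int h" by simp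
    then have "\<bar>int (J u)\<bar> * \<bar>int u - int v\<bar> < 1"
      using h by (simp add: abs_mult)
    moreover have "J u \<ge> 1" using Jn(1)[of u] u by auto
    then have "1 * \<bar>int u - int v\<bar> \<le> \<bar>int (J u)\<bar> * \<bar>int u - int v\<bar>"
      by (intro mult_right_mono) auto
    ultimately have "\<bar>int u - int v\<bar> < 1" by simp
    then show "u = v" by linarith
  qed
  have "(\<lambda>u. (J u, n u)) ` ?I \<subseteq> {1..<s} \<times> {1..c}"
    using Jn nle by auto
  then have "card ?I \<le> card ({1..<s} \<times> {1..c})"
    using inj by (intro card_inj_on_le) auto
  then have "b ^ 2 \<le> (s - 1) * c" by (simp add: card_cartesian_product)
  also have "\<dots> \<le> s * c" by simp
  also have "\<dots> = 7 * h * s ^ 2 * b" by (simp add: c_def power2_eq_square algebra_simps)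
  also have "\<dots> < b * b" using b1 h s by (simp add: b_def)
  finally show False by (simp add: power2_eq_square)
qed

text \<open>
  The conditions on \<open>q k\<close> involve \<open>h k\<close>, hence only \<open>q 0, \<dots>, q (k - 1)\<close>; this makes a recursive choice
  possible.
\<close>

lemma odometer_avoiding:
  fixes a :: "nat \<Rightarrow> nat"
  assumes a: "\<And>n. n \<ge> 1 \<Longrightarrow> n ^ 2 \<le> a n"
  shows "\<exists>q. odometer q \<and> odometer.spread q (a ` {1..})"
proof -
  define c where "c h k = (SOME t. t \<ge> 4 \<and> (\<forall>j\<in>{1..<k+2}. \<forall>n\<ge>1. int h \<le> \<bar>int (a n) - int (j * (t * h))\<bar>))" for h k
  have c: "c h k \<ge> 4 \<and> (\<forall>j\<in>{1..<k+2}. \<forall>n\<ge>1. int h \<le> \<bar>int (a n) - int (j * (c h k * h))\<bar>)" if "h \<ge> 1" for h k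
    unfolding c_def by (rule someI_ex, rule sparse_multiple_exists[OF a that]) auto
  define H where "H = rec_nat 1 (\<lambda>k h. h * ((k + 2) * c h k))"
  have H0: "H 0 = 1" and HS: "H (Suc k) = H k * ((k + 2) * c (H k) k)" for k by (simp_all add: H_def)
  have H1: "H k \<ge> 1" for k
  proof (induction k)
    case (Suc k)
    then show ?case using c[OF Suc, of k] by (simp add: HS)
  qed (simp add: H0)
  define q where "q k = c (H k) k" for k
  interpret odometer q using c[OF H1] by unfold_locales (simp add: q_def)
  have hH: "h k = H k" for k
  proof (induction k)
    case (Suc k)
    show ?case unfolding h_Suc HS Suc r_def by (simp only: q_def)
  qed (simp only: H0 h_0)
  have "spread (a ` {1..})"
    unfolding spread_def hH using c[OF H1] by (auto simp only: q_def)
  then show ?thesis using odometer_axioms by blast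
qed

section \<open>The measures on coins and on digits\<close>

instance bool :: second_countable_topology
proof
  show "\<exists>B::bool set set. countable B \<and> open = generate_topology B"
  proof (intro exI[of _ UNIV] conjI)
    show "countable (UNIV :: bool set set)" by (rule countable_finite) simp
    show "open = generate_topology (UNIV :: bool set set)"
      by (auto simp: fun_eq_iff intro: generate_topology.Basis discrete_topology_class.open_discrete)
  qed
qed

definition coin_measure :: "(int \<Rightarrow> bool) measure" where
  "coin_measure = PiM UNIV (\<lambda>_. measure_pmf (pmf_of_set UNIV))"

definition shift_by :: "int \<Rightarrow> (int \<Rightarrow> bool) \<Rightarrow> int \<Rightarrow> bool" where
  "shift_by c x = (\<lambda>i. x (i + c))"

text \<open>
  The coin at the origin is exempt so that the flip maps the event of heads at the origin to itself.
\<close>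

definition flip_off_origin :: "(int \<Rightarrow> bool) \<Rightarrow> int \<Rightarrow> bool" where
  "flip_off_origin x = (\<lambda>i. if i = 0 then x i else \<not> x i)"

interpretation coin: product_prob_space "\<lambda>_. measure_pmf (pmf_of_set (UNIV :: bool set))" "UNIV :: int set"
  by unfold_locales

lemma prob_space_coin: "prob_space coin_measure"
  unfolding coin_measure_def by (rule coin.P.prob_space_axioms)

lemma space_coin [simp]: "space coin_measure = UNIV"
  by (simp add: coin_measure_def space_PiM)

lemma UNIV_coin [simp]: "UNIV \<in> sets coin_measure"
  using sets.top[of coin_measure] by simp

lemma sets_coin: "sets coin_measure = sets borel"
proof -
  have "sets coin_measure = sets (PiM UNIV (\<lambda>_::int. borel :: bool measure))"
    unfolding coin_measure_def by (rule sets_PiM_cong) (simp_all add: sets_borel_eq_count_space)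
  then show ?thesis by (simp add: sets_PiM_equal_borel)
qed

lemma measurable_coin_component [measurable]: "(\<lambda>x. x i) \<in> measurable coin_measure (count_space UNIV)"
proof -
  have "(\<lambda>x. x i) \<in> measurable coin_measure (measure_pmf (pmf_of_set UNIV))"
    unfolding coin_measure_def by (rule measurable_component_singleton) simp
  then show ?thesis by simp
qed

lemma measurable_into_coin:
  "(\<And>i. (\<lambda>w. f w i) \<in> measurable M (count_space UNIV)) \<Longrightarrow> f \<in> measurable M coin_measure"
  unfolding coin_measure_def
  by (rule measurable_PiM_single') (auto simp: space_PiM)

lemma measurable_shift [measurable]: "shift_by c \<in> measurable coin_measure coin_measure"
  by (rule measurable_into_coin) (simp add: shift_by_def)

lemma distr_shift: "distr coin_measure coin_measure (shift_by c) = coin_measure"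
proof -
  have "distr (Pi\<^sub>M UNIV (\<lambda>_::int. measure_pmf (pmf_of_set (UNIV::bool set)))) (Pi\<^sub>M UNIV (\<lambda>i. measure_pmf (pmf_of_set UNIV)))
     (\<lambda>w. \<lambda>n\<in>UNIV. w (n + c)) = Pi\<^sub>M UNIV (\<lambda>i. measure_pmf (pmf_of_set UNIV))"
    by (rule distr_PiM_reindex[of UNIV "\<lambda>_. measure_pmf (pmf_of_set UNIV)" "\<lambda>n. n + c"])
      (auto simp: measure_pmf.prob_space_axioms)
  then show ?thesis by (simp add: coin_measure_def shift_by_def[abs_def] restrict_def)
qed

lemma measurable_flip [measurable]: "flip_off_origin \<in> measurable coin_measure coin_measure"
proof (rule measurable_into_coin)
  fix i
  have "(\<lambda>x. \<not> x i) \<in> measurable coin_measure (count_space UNIV)"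
    by (rule measurable_compose[OF measurable_coin_component]) simp
  then show "(\<lambda>w. flip_off_origin w i) \<in> measurable coin_measure (count_space UNIV)"
    by (simp add: flip_off_origin_def)
qed

lemma flip_flip [simp]: "flip_off_origin (flip_off_origin x) = x"
  by (auto simp: flip_off_origin_def)

lemma distr_flip: "distr coin_measure coin_measure flip_off_origin = coin_measure"
  unfolding coin_measure_def
proof (rule coin.PiM_eq)
  let ?b = "measure_pmf (pmf_of_set (UNIV :: bool set))"
  let ?P = "PiM UNIV (\<lambda>_::int. ?b)"
  fix J :: "int set" and F :: "int \<Rightarrow> bool set"
  assume J: "finite J"
  define g where "g i b = (if i = (0::int) then b else \<not> b)" for i b
  have inv: "emeasure ?b (g j -` B) = emeasure ?b B" for j B
  proof -
    have "map_pmf (g j) (pmf_of_set UNIV) = pmf_of_set UNIV"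
      by (rule map_pmf_of_set_bij_betw) (auto simp: bij_betw_def inj_on_def g_def surj_def)
    then have "emeasure ?b B = emeasure (measure_pmf (map_pmf (g j) (pmf_of_set UNIV))) B" by simp
    then show ?thesis by (simp add: emeasure_map_pmf)
  qed
  have "emeasure (distr ?P ?P flip_off_origin) (prod_emb UNIV (\<lambda>_. ?b) J (Pi\<^sub>E J F))
     = emeasure ?P (flip_off_origin -` (prod_emb UNIV (\<lambda>_. ?b) J (Pi\<^sub>E J F)) \<inter> space ?P)"
    using J measurable_flip by (intro emeasure_distr sets_PiM_I) (auto simp: coin_measure_def)
  also have "flip_off_origin -` (prod_emb UNIV (\<lambda>_. ?b) J (Pi\<^sub>E J F)) \<inter> space ?P
     = {x \<in> space ?P. \<forall>j\<in>J. x j \<in> g j -` F j}"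
  proof -
    have "flip_off_origin x j = g j (x j)" for x j by (simp add: flip_off_origin_def g_def)
    then show ?thesis by (auto simp: prod_emb_def space_PiM PiE_iff)
  qed
  also have "emeasure ?P \<dots> = (\<Prod>j\<in>J. emeasure ?b (g j -` F j))"
    using J by (intro coin.emeasure_PiM_Collect) auto
  finally show "emeasure (distr ?P ?P flip_off_origin) (prod_emb UNIV (\<lambda>_. ?b) J (Pi\<^sub>E J F)) = (\<Prod>j\<in>J. emeasure ?b (F j))"
    by (simp add: inv)
qed simp

text \<open>
  Events that depend on disjoint sets of coins are images under restriction maps of events in the
  corresponding subproducts; \<open>ext\<close> undoes the restriction.
\<close>

lemma coin_windows_independent:
  assumes A: "A \<in> sets coin_measure" and B: "B \<in> sets coin_measure"
    and dA: "\<And>x y. (\<And>i. i \<in> I \<Longrightarrow> x i = y i) \<Longrightarrow> x \<in> A \<longleftrightarrow> y \<in> A"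
    and dB: "\<And>x y. (\<And>i. i \<in> J \<Longrightarrow> x i = y i) \<Longrightarrow> x \<in> B \<longleftrightarrow> y \<in> B"
    and IJ: "I \<inter> J = {}"
  shows "measure coin_measure (A \<inter> B) = measure coin_measure A * measure coin_measure B"
proof -
  interpret prob_space coin_measure by (rule prob_space_coin)
  let ?b = "measure_pmf (pmf_of_set (UNIV :: bool set))"
  have "indep_vars (\<lambda>_. ?b) (\<lambda>i x. x i) UNIV"
  proof (subst indep_vars_iff_distr_eq_PiM')
    have "distr coin_measure (PiM UNIV (\<lambda>_. ?b)) (\<lambda>x. \<lambda>i\<in>UNIV. x i) = coin_measure"
      using distr_shift[of 0] by (simp add: shift_by_def[abs_def] coin_measure_def restrict_def)
    moreover have "distr coin_measure ?b (\<lambda>x. x i) = ?b" for i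
      unfolding coin_measure_def by (rule coin.PiM_component) simp
    ultimately show "distr coin_measure (PiM UNIV (\<lambda>_. ?b)) (\<lambda>x. \<lambda>i\<in>UNIV. x i) = PiM UNIV (\<lambda>i. distr coin_measure ?b (\<lambda>x. x i))"
      by (simp add: coin_measure_def)
  qed auto
  then have ind: "indep_var (PiM I (\<lambda>_. ?b)) (\<lambda>x. restrict (\<lambda>i. x i) I) (PiM J (\<lambda>_. ?b)) (\<lambda>x. restrict (\<lambda>i. x i) J)"
    by (rule indep_var_restrict) (use IJ in auto)
  define ext where "ext z K = (\<lambda>i. if i \<in> K then z i else False)" for z :: "int \<Rightarrow> bool" and K
  have ext: "(\<lambda>z. ext z K) \<in> measurable (PiM K (\<lambda>_. ?b)) coin_measure" for K
  proof (rule measurable_into_coin)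
    fix i
    have "(\<lambda>z. z i) \<in> measurable (PiM K (\<lambda>_. ?b)) (count_space UNIV)" if "i \<in> K"
      using measurable_component_singleton[OF that, of "\<lambda>_. ?b"] by simp
    then show "(\<lambda>z. ext z K i) \<in> measurable (PiM K (\<lambda>_. ?b)) (count_space UNIV)"
      by (cases "i \<in> K") (simp_all add: ext_def)
  qed
  have pre: "(\<lambda>x. restrict (\<lambda>i. x i) K) -` ((\<lambda>z. ext z K) -` C \<inter> space (PiM K (\<lambda>_. ?b))) \<inter> space coin_measure = C"
    if "\<And>x y. (\<And>i. i \<in> K \<Longrightarrow> x i = y i) \<Longrightarrow> x \<in> C \<longleftrightarrow> y \<in> C" for K C
  proof -
    have "ext (restrict (\<lambda>i. x i) K) K \<in> C \<longleftrightarrow> x \<in> C" for x by (rule that) (simp add: ext_def)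
    then show ?thesis by (auto simp: space_PiM)
  qed
  let ?A = "(\<lambda>z. ext z I) -` A \<inter> space (PiM I (\<lambda>_. ?b))"
  let ?B = "(\<lambda>z. ext z J) -` B \<inter> space (PiM J (\<lambda>_. ?b))"
  have "prob ((\<lambda>x. (restrict (\<lambda>i. x i) I)) -` ?A \<inter> space coin_measure \<inter> ((\<lambda>x. (restrict (\<lambda>i. x i) J)) -` ?B \<inter> space coin_measure))
      = prob ((\<lambda>x. (restrict (\<lambda>i. x i) I)) -` ?A \<inter> space coin_measure) * prob ((\<lambda>x. (restrict (\<lambda>i. x i) J)) -` ?B \<inter> space coin_measure)"
  proof -
    have "(\<lambda>x. (restrict (\<lambda>i. x i) I, restrict (\<lambda>i. x i) J)) -` (?A \<times> ?B) \<inter> space coin_measure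
        = (\<lambda>x. (restrict (\<lambda>i. x i) I)) -` ?A \<inter> space coin_measure \<inter> ((\<lambda>x. (restrict (\<lambda>i. x i) J)) -` ?B \<inter> space coin_measure)"
      by auto
    then show ?thesis
      using indep_varD[OF ind measurable_sets[OF ext A] measurable_sets[OF ext B]] by simp
  qed
  moreover have "(\<lambda>x. restrict (\<lambda>i. x i) I) -` ?A \<inter> space coin_measure = A" by (rule pre) (rule dA)
  moreover have "(\<lambda>x. restrict (\<lambda>i. x i) J) -` ?B \<inter> space coin_measure = B" by (rule pre) (rule dB)
  ultimately show ?thesis by simp
qed

context odometer
begin

definition digit_measure :: "(nat \<Rightarrow> nat) measure" where
  "digit_measure = PiM UNIV (\<lambda>k. measure_pmf (pmf_of_set {..<r k}))"

lemma product_prob_digits: "product_prob_space (\<lambda>k. measure_pmf (pmf_of_set {..<r k}))"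
  by unfold_locales

lemma prob_space_digit: "prob_space digit_measure"
  unfolding digit_measure_def by (rule prob_space_PiM) (rule measure_pmf.prob_space_axioms)

lemma space_digit [simp]: "space digit_measure = UNIV"
  by (simp add: digit_measure_def space_PiM)

lemma sets_digit: "sets digit_measure = sets borel"
proof -
  have "sets digit_measure = sets (PiM UNIV (\<lambda>_::nat. borel :: nat measure))"
    unfolding digit_measure_def by (rule sets_PiM_cong) (simp_all add: sets_borel_eq_count_space)
  then show ?thesis by (simp add: sets_PiM_equal_borel)
qed

lemma measurable_digit_component [measurable]: "(\<lambda>d. d k) \<in> measurable digit_measure (count_space UNIV)"
proof -
  have "(\<lambda>d. d k) \<in> measurable digit_measure (measure_pmf (pmf_of_set {..<r k}))"
    unfolding digit_measure_def by (rule measurable_component_singleton) simp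
  then show ?thesis by simp
qed

lemma measurable_into_digit:
  "(\<And>k. (\<lambda>w. f w k) \<in> measurable M (count_space UNIV)) \<Longrightarrow> f \<in> measurable M digit_measure"
  unfolding digit_measure_def
  by (rule measurable_PiM_single') (auto simp: space_PiM)

lemma AE_digits_less: "AE d in digit_measure. \<forall>k. d k < r k"
proof -
  have "AE d in digit_measure. d k < r k" for k
  proof -
    have "AE a in measure_pmf (pmf_of_set {..<r k}). a < r k"
      using r_pos[of k] by (auto simp: AE_measure_pmf_iff set_pmf_of_set lessThan_empty_iff)
    then show ?thesis unfolding digit_measure_def
      by (intro AE_PiM_component) (auto simp: measure_pmf.prob_space_axioms)
  qed
  then show ?thesis by (simp add: AE_all_countable)
qed

lemma measurable_position [measurable]: "position K \<in> measurable digit_measure (count_space UNIV)"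
proof (induction K)
  case 0
  have "position 0 = (\<lambda>_. 0)" by (simp add: fun_eq_iff)
  then show ?case by simp
next
  case (Suc K)
  have "(\<lambda>d. position K d + (d K mod r K) * h K) \<in> measurable digit_measure (count_space UNIV)"
  proof (rule measurable_compose_countable[OF _ Suc])
    show "(\<lambda>d. v + (d K mod r K) * h K) \<in> measurable digit_measure (count_space UNIV)" for v
      by (rule measurable_compose[OF measurable_digit_component]) simp
  qed
  then show ?case by (simp add: position_Suc[abs_def])
qed

lemma position_eq_iff: "v < h K \<Longrightarrow> position K d = v \<longleftrightarrow> (\<forall>j<K. d j mod r j = digit j v)"
proof
  assume v: "v < h K"
  show "\<forall>j<K. d j mod r j = digit j v" if "position K d = v" using that digit_position[of _ K d] by auto
  assume "\<forall>j<K. d j mod r j = digit j v"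
  then have "position K d = position K (\<lambda>j. digit j v)" by (intro position_cong) simp
  then show "position K d = v" using v by (simp add: position_digit)
qed

lemma distr_position: "distr digit_measure (count_space UNIV) (position K) = measure_pmf (pmf_of_set {..<h K})"
proof (rule measure_eqI_countable[of _ UNIV])
  interpret product_prob_space "\<lambda>k. measure_pmf (pmf_of_set {..<r k})" "UNIV" by (rule product_prob_digits)
  fix v :: nat
  have ne: "{..<h k} \<noteq> {}" "{..<r k} \<noteq> {}" for k using h_pos[of k] r_pos[of k] by (auto simp: lessThan_empty_iff)
  have "emeasure (distr digit_measure (count_space UNIV) (position K)) {v} = emeasure digit_measure {d. position K d = v}"
    by (subst emeasure_distr) (auto simp: vimage_def)
  also have "\<dots> = emeasure (measure_pmf (pmf_of_set {..<h K})) {v}"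
  proof (cases "v < h K")
    case True
    have one: "emeasure (measure_pmf (pmf_of_set {..<r j})) {a. a mod r j = digit j v} = ennreal (1 / real (r j))" for j
    proof -
      have "{..<r j} \<inter> {a. a mod r j = digit j v} = {digit j v}" by auto
      then show ?thesis by (simp add: emeasure_pmf_of_set ne)
    qed
    have "{d. position K d = v} = {d \<in> space digit_measure. \<forall>j\<in>{..<K}. d j \<in> {a. a mod r j = digit j v}}"
      by (auto simp: position_eq_iff[OF True])
    then have "emeasure digit_measure {d. position K d = v} = (\<Prod>j<K. ennreal (1 / real (r j)))"
      unfolding digit_measure_def by (simp only: emeasure_PiM_Collect[of "{..<K}"] one subset_UNIV finite_lessThan sets_measure_pmf UNIV_I)
    also have "\<dots> = ennreal (1 / real (h K))"
      by (subst prod_ennreal) (simp_all add: h_def prod_dividef)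
    finally show ?thesis using True by (simp add: emeasure_pmf_of_set ne)
  next
    case False
    then have "{d. position K d = v} = {}" using position_less by auto
    then show ?thesis using False by (simp add: emeasure_pmf_of_set ne)
  qed
  finally show "emeasure (distr digit_measure (count_space UNIV) (position K)) {v} = emeasure (measure_pmf (pmf_of_set {..<h K})) {v}" .
qed auto

text \<open>
  The first \<open>J\<close> digits of a point in range are encoded by its position, which is uniformly distributed.
  A map that permutes the positions at all high levels therefore preserves the law of all finite
  sets of digits.
\<close>

lemma distr_digit_map:
  assumes f: "f \<in> measurable digit_measure digit_measure" and rng: "\<And>d k. f d k < r k"
    and bij: "\<And>J. J \<ge> L \<Longrightarrow> bij_betw (s J) {..<h J} {..<h J}"
    and position: "\<And>J d. J \<ge> L \<Longrightarrow> position J (f d) = s J (position J d)"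
  shows "distr digit_measure digit_measure f = digit_measure"
proof -
  interpret product_prob_space "\<lambda>k. measure_pmf (pmf_of_set {..<r k})" "UNIV" by (rule product_prob_digits)
  let ?m = "\<lambda>k. measure_pmf (pmf_of_set {..<r k})"
  have "distr (PiM UNIV ?m) (PiM UNIV ?m) f = PiM UNIV ?m"
  proof (rule PiM_eq)
    fix J :: "nat set" and F :: "nat \<Rightarrow> nat set"
    assume J: "finite J"
    obtain K where K: "K \<ge> L" "\<forall>j\<in>J. j < K"
      using J by (metis finite_nat_bounded le_max_iff_disj lessThan_iff max.cobounded1 max.strict_coboundedI2 nle_le subsetD)
    define V where "V = {v. \<forall>j\<in>J. digit j v \<in> F j}"
    let ?E = "prod_emb UNIV ?m J (Pi\<^sub>E J F)"
    have Es: "?E \<in> sets (PiM UNIV ?m)" using J by (intro sets_PiM_I) auto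
    have E: "d \<in> ?E \<longleftrightarrow> position K d \<in> V" if "\<forall>k. d k < r k" for d
      using that K(2) by (auto simp: prod_emb_def V_def digit_position PiE_iff)
    have "emeasure (distr (PiM UNIV ?m) (PiM UNIV ?m) f) ?E = emeasure digit_measure (f -` ?E \<inter> space digit_measure)"
      using f Es by (subst emeasure_distr) (auto simp: digit_measure_def)
    also have "f -` ?E \<inter> space digit_measure = position K -` (s K -` V) \<inter> space digit_measure"
      using E[of "f _"] rng position[OF K(1)] by auto
    also have "emeasure digit_measure \<dots> = emeasure (measure_pmf (pmf_of_set {..<h K})) (s K -` V)"
      unfolding distr_position[symmetric] by (subst emeasure_distr) auto
    also have "\<dots> = emeasure (measure_pmf (map_pmf (s K) (pmf_of_set {..<h K}))) V"
      by (simp add: emeasure_map_pmf)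
    also have "map_pmf (s K) (pmf_of_set {..<h K}) = pmf_of_set {..<h K}"
      using h_pos[of K] by (intro map_pmf_of_set_bij_betw bij K) (auto simp: lessThan_empty_iff)
    also have "emeasure (measure_pmf (pmf_of_set {..<h K})) V = emeasure digit_measure (position K -` V \<inter> space digit_measure)"
      unfolding distr_position[symmetric] by (subst emeasure_distr) auto
    also have "\<dots> = emeasure digit_measure ?E"
    proof (rule emeasure_eq_AE)
      show "AE d in digit_measure. d \<in> position K -` V \<inter> space digit_measure \<longleftrightarrow> d \<in> ?E"
        using AE_digits_less by eventually_elim (simp add: E)
      show "?E \<in> sets digit_measure" using Es by (simp add: digit_measure_def)
      show "position K -` V \<inter> space digit_measure \<in> sets digit_measure" by (rule measurable_sets[OF measurable_position]) simp
    qed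
    also have "\<dots> = (\<Prod>j\<in>J. emeasure (?m j) (F j))"
      unfolding digit_measure_def using J by (intro emeasure_PiM_emb) auto
    finally show "emeasure (distr (PiM UNIV ?m) (PiM UNIV ?m) f) ?E = (\<Prod>j\<in>J. emeasure (?m j) (F j))" .
  qed simp
  then show ?thesis by (simp add: digit_measure_def)
qed

end

section \<open>The skew product and its rigidity\<close>

lemma bij_betw_add_mod: "bij_betw (\<lambda>v. (v + j) mod m) {..<m} {..<m::nat}"
proof (cases "m = 0")
  case False
  have "((v + j) mod m + (m - j mod m)) mod m = v" "((v + (m - j mod m)) mod m + j) mod m = v" if "v < m" for v
  proof -
    have "j mod m < m" using False by simp
    then have "v + j + (m - j mod m) = v + m * (j div m + 1)"
      using mult_div_mod_eq[of m j] unfolding distrib_left by linarith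
    then have *: "(v + j + (m - j mod m)) mod m = v" using that by (simp only: mod_mult_self2 mod_less)
    then show "((v + j) mod m + (m - j mod m)) mod m = v" by (simp add: mod_add_left_eq)
    show "((v + (m - j mod m)) mod m + j) mod m = v"
      using * by (simp add: mod_add_left_eq add.assoc add.commute[of j])
  qed
  then show ?thesis using False
    by (intro bij_betw_byWitness[where f' = "\<lambda>v. (v + (m - j mod m)) mod m"]) auto
qed (simp add: bij_betw_def)

text \<open>
  Permuting the last digit of numbers written to base \<open>m\<close>.
\<close>

lemma bij_betw_blockwise:
  fixes p :: "nat \<Rightarrow> nat"
  assumes p: "bij_betw p {..<m} {..<m}" and dvd: "m dvd n"
  shows "bij_betw (\<lambda>v. p (v mod m) + (v - v mod m)) {..<n} {..<n}" (is "bij_betw ?s _ _")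
proof (cases "m = 0")
  case True
  then show ?thesis using dvd by (simp add: bij_betw_def)
next
  case False
  have pm: "p (v mod m) < m" for v using bij_betwE[OF p] False by auto
  have md: "?s v mod m = p (v mod m)" "?s v div m = v div m" for v
  proof -
    have "?s v = p (v mod m) + m * (v div m)" by (simp add: minus_mod_eq_mult_div)
    then show "?s v mod m = p (v mod m)" "?s v div m = v div m" using pm[of v] False by simp_all
  qed
  have inj: "inj_on ?s {..<n}"
  proof (rule inj_onI)
    fix v w assume "?s v = ?s w"
    then have "p (v mod m) = p (w mod m)" "v div m = w div m" using md by metis+
    moreover have "v mod m = w mod m"
      using calculation(1) bij_betw_imp_inj_on[OF p] False by (auto dest: inj_onD)
    ultimately show "v = w" by (metis div_mult_mod_eq)
  qed
  have "?s v < n" if "v < n" for v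
  proof -
    obtain c where n: "n = m * c" using dvd by auto
    have "v div m < c" using that n by (simp add: less_mult_imp_div_less mult.commute)
    then have "?s v div m < c" unfolding md .
    then show ?thesis using n False by (simp add: div_less_iff_less_mult mult.commute)
  qed
  then have "?s ` {..<n} \<subseteq> {..<n}" by auto
  then show ?thesis using inj by (simp add: bij_betw_def endo_inj_surj)
qed

lemma measure_preserving_mapI:
  assumes "T \<in> measurable M M" "distr M M T = M"
  shows "measure_preserving_map M T"
  unfolding measure_preserving_map_def
proof (intro conjI ballI assms(1))
  fix A assume "A \<in> sets M"
  then show "emeasure M (T -` A \<inter> space M) = emeasure M A"
    using emeasure_distr[OF assms(1), of A] by (simp add: assms(2))
qed

lemma shift_by_0 [simp]: "shift_by 0 x = x" by (simp add: shift_by_def)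
lemma shift_by_shift_by [simp]: "shift_by a (shift_by b x) = shift_by (a + b) x"
  by (simp add: shift_by_def fun_eq_iff add.assoc)

context odometer
begin

text \<open>
  The least level at which adding one does not overflow. It exists for almost every \<open>d\<close>.
\<close>

definition carry_level :: "(nat \<Rightarrow> nat) \<Rightarrow> nat" where "carry_level d = (LEAST K. position K d + 1 < h K)"
definition cocycle :: "(nat \<Rightarrow> nat) \<Rightarrow> int" where
  "cocycle d = site (carry_level d) (add 1 d) - site (carry_level d) d"
definition T :: "(nat \<Rightarrow> nat) \<times> (int \<Rightarrow> bool) \<Rightarrow> (nat \<Rightarrow> nat) \<times> (int \<Rightarrow> bool)" where
  "T = (\<lambda>(d, x). (add 1 d, shift_by (cocycle d) x))"
definition M :: "((nat \<Rightarrow> nat) \<times> (int \<Rightarrow> bool)) measure" where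
  "M = digit_measure \<Otimes>\<^sub>M coin_measure"

lemma site_add_diff:
  assumes "position K d + n < h K" "K \<le> J"
  shows "site J (add n d) - site J d = site K (add n d) - site K d"
  using assms(2)
proof (induction J rule: dec_induct)
  case (step J)
  have "\<not> J < K" using step(1) by simp
  then have "add n d J = d J mod r J"
    unfolding add_eq_replace[OF assms(1)] replace_def by (simp only: if_False)
  then have "int ((add n d J mod q J) * sites J) = int ((d J mod q J) * sites J)" by (simp only: mod_r_mod_q)
  then have "site (Suc J) (add n d) - site (Suc J) d = site J (add n d) - site J d"
    by (simp only: site_Suc add_diff_cancel_right)
  then show ?case using step(3) by (rule trans)
qed simp

lemma cocycle_eq:
  assumes "position K d + 1 < h K"
  shows "cocycle d = site K (add 1 d) - site K d"
proof -
  have "position (carry_level d) d + 1 < h (carry_level d)" "carry_level d \<le> K"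
    unfolding carry_level_def using assms by (rule LeastI, rule Least_le)
  then show ?thesis unfolding cocycle_def by (metis site_add_diff)
qed

text \<open>
  As long as an orbit stays in one level-\<open>K\<close> block, the cocycle telescopes to a difference of sites.
\<close>

lemma T_iterate:
  "position K d + Suc n < h K \<Longrightarrow>
    (T ^^ Suc n) (d, x) = (add (Suc n) d, shift_by (site K (add (Suc n) d) - site K d) x)"
proof (induction n)
  case 0
  then show ?case using cocycle_eq[of K d] by (simp add: T_def)
next
  case (Suc n)
  let ?d = "add (Suc n) d"
  have "position K ?d = position K d + Suc n" using Suc.prems by (simp add: position_add)
  then have "cocycle ?d = site K (add 1 ?d) - site K ?d" using Suc.prems by (intro cocycle_eq) simp
  moreover have "add 1 ?d = add (Suc (Suc n)) d" by (simp add: add_add)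
  moreover have "(T ^^ Suc (Suc n)) (d, x) = T ((T ^^ Suc n) (d, x))" by simp
  ultimately show ?case using Suc by (simp add: T_def)
qed

lemma prob_space_M: "prob_space M"
proof -
  interpret pair_prob_space digit_measure coin_measure
    by (simp add: pair_prob_space_def pair_sigma_finite_def prob_space_digit prob_space_coin prob_space_imp_sigma_finite)
  show ?thesis unfolding M_def by (rule P.prob_space_axioms)
qed

lemma space_M [simp]: "space M = UNIV" by (simp add: M_def space_pair_measure)

lemma sets_M: "sets M = sets borel"
  unfolding M_def using sets_pair_measure_cong[OF sets_digit sets_coin] unfolding borel_prod .

lemma measurable_fst_M: "fst \<in> measurable M digit_measure" and measurable_snd_M: "snd \<in> measurable M coin_measure"
  by (simp_all add: M_def)

lemma measurable_site: "site K \<in> measurable digit_measure (count_space UNIV)"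
proof (induction K)
  case 0
  have "site 0 = (\<lambda>_. 0)" by (simp add: fun_eq_iff)
  then show ?case by simp
next
  case (Suc K)
  have "(\<lambda>d. site K d + int ((d K mod q K) * sites K)) \<in> measurable digit_measure (count_space UNIV)"
  proof (rule measurable_compose_countable[OF _ Suc])
    show "(\<lambda>d. v + int ((d K mod q K) * sites K)) \<in> measurable digit_measure (count_space UNIV)" for v
      by (rule measurable_compose[OF measurable_digit_component]) simp
  qed
  then show ?case by (simp add: site_Suc[abs_def])
qed

lemma measurable_add: "add n \<in> measurable digit_measure digit_measure"
  by (rule measurable_into_digit) (simp add: add_def measurable_compose[OF measurable_position])

lemma measurable_site_diff:
  assumes "f \<in> measurable digit_measure digit_measure"
  shows "(\<lambda>d. site K (f d) - site K d) \<in> measurable digit_measure (count_space UNIV)"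
proof (rule measurable_compose_countable[OF _ measurable_site])
  show "(\<lambda>d. site K (f d) - v) \<in> measurable digit_measure (count_space UNIV)" for v
    by (rule measurable_compose[OF measurable_compose[OF assms measurable_site]]) simp
qed

lemma measurable_cocycle: "cocycle \<in> measurable digit_measure (count_space UNIV)"
  unfolding cocycle_def
proof (rule measurable_compose_countable[OF measurable_site_diff[OF measurable_add]])
  have "Measurable.pred digit_measure (\<lambda>d. position K d + 1 < h K)" for K
    by (rule measurable_compose[OF measurable_position]) simp
  then show "carry_level \<in> measurable digit_measure (count_space UNIV)"
    unfolding carry_level_def by (rule measurable_Least)
qed

lemma skew_product_preserves:
  assumes f: "f \<in> measurable digit_measure digit_measure" "distr digit_measure digit_measure f = digit_measure"
    and c: "c \<in> measurable digit_measure (count_space UNIV)"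
  shows "measure_preserving_map M (\<lambda>(d, x). (f d, shift_by (c d) x))"
proof -
  have "(\<lambda>p. shift_by (c (fst p)) (snd p)) \<in> measurable (digit_measure \<Otimes>\<^sub>M coin_measure) coin_measure"
    by (rule measurable_compose_countable[OF measurable_compose[OF measurable_snd measurable_shift] measurable_compose[OF measurable_fst c]])
  then have g: "(\<lambda>(d, x). shift_by (c d) x) \<in> measurable (digit_measure \<Otimes>\<^sub>M coin_measure) coin_measure"
    by (simp add: split_def)
  show ?thesis
    using distr_skew_product[OF prob_space_digit prob_space_coin f distr_shift g]
    unfolding M_def by (rule measure_preserving_mapI)
qed

lemma measure_preserving_T: "measure_preserving_map M T"
  unfolding T_def
proof (rule skew_product_preserves[OF measurable_add _ measurable_cocycle])
  show "distr digit_measure digit_measure (add 1) = digit_measure"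
  proof (rule distr_digit_map[where L = 0 and s = "\<lambda>J v. (v + 1) mod h J"])
    show "add 1 d k < r k" for d k by (simp add: add_def)
  qed (rule measurable_add position_add bij_betw_add_mod)+
qed

lemma T_measurable: "T \<in> measurable M M"
  using measure_preserving_T by (simp add: measure_preserving_map_def)

lemma T_iterate_measurable: "T ^^ n \<in> measurable M M"
proof (induction n)
  case (Suc n)
  show ?case unfolding funpow.simps by (rule measurable_comp[OF Suc T_measurable])
qed (simp add: id_def)

lemma AE_M_fst: "(AE d in digit_measure. P d) \<Longrightarrow> AE p in M. P (fst p)"
proof -
  assume P: "AE d in digit_measure. P d"
  interpret X: prob_space coin_measure by (rule prob_space_coin)
  have fst: "distr M digit_measure fst = digit_measure" unfolding M_def by (rule X.distr_pair_fst)
  have "AE d in distr M digit_measure fst. P d" unfolding fst by (rule P)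
  then show ?thesis by (rule AE_distrD[OF measurable_fst_M])
qed

lemma AE_M_digits: "AE p in M. \<forall>k. fst p k < r k"
  by (rule AE_M_fst[OF AE_digits_less])

lemma measure_position_set: "measure digit_measure (position K -` S) = card ({..<h K} \<inter> S) / h K"
proof -
  have "measure digit_measure (position K -` S) = measure (distr digit_measure (count_space UNIV) (position K)) S"
    by (subst measure_distr) auto
  also have "\<dots> = card ({..<h K} \<inter> S) / card {..<h K}"
    unfolding distr_position using h_pos[of K] by (intro measure_pmf_of_set) (auto simp: lessThan_empty_iff)
  finally show ?thesis by simp
qed

lemma measure_overflow: "n \<le> h K \<Longrightarrow> measure digit_measure {d. \<not> position K d + n < h K} = n / h K"
proof -
  assume n: "n \<le> h K"
  have "{d. \<not> position K d + n < h K} = position K -` {h K - n..}" using n by auto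
  moreover have "{..<h K} \<inter> {h K - n..} = {h K - n..<h K}" by auto
  ultimately show ?thesis using n by (simp add: measure_position_set)
qed

text \<open>
  Membership is determined by the digits below \<open>K\<close> and the coins in the window from \<open>-W\<close> to \<open>W\<close>.
\<close>

definition cylinder :: "nat \<Rightarrow> nat \<Rightarrow> ((nat \<Rightarrow> nat) \<times> (int \<Rightarrow> bool)) set \<Rightarrow> bool" where
  "cylinder K W C \<longleftrightarrow> C \<in> sets M \<and>
     (\<forall>d d' x x'. (\<forall>i<K. d i = d' i) \<and> (\<forall>i. \<bar>i\<bar> \<le> int W \<longrightarrow> x i = x' i) \<longrightarrow> ((d, x) \<in> C \<longleftrightarrow> (d', x') \<in> C))"

lemma cylinder_mono: "cylinder K W C \<Longrightarrow> K \<le> K' \<Longrightarrow> W \<le> W' \<Longrightarrow> cylinder K' W' C"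
  unfolding cylinder_def by (smt (verit) less_le_trans of_nat_mono)

lemma cylinders_generate:
  "algebra UNIV {C. \<exists>K W. cylinder K W C}" "sets M = sigma_sets UNIV {C. \<exists>K W. cylinder K W C}"
proof -
  let ?A = "{C. \<exists>K W. cylinder K W C}"
  show "algebra UNIV ?A"
  proof (rule algebra_iff_Un[THEN iffD2], intro conjI ballI)
    have "cylinder 0 0 {}" by (simp add: cylinder_def)
    then show "{} \<in> ?A" by blast
    show "UNIV - a \<in> ?A" if a: "a \<in> ?A" for a
    proof -
      have "UNIV - a \<in> sets M" if "a \<in> sets M" using sets.compl_sets[OF that] by simp
      then have "cylinder K W (UNIV - a)" if "cylinder K W a" for K W
        using that unfolding cylinder_def by blast
      then show ?thesis using a by blast
    qed
    fix a b assume "a \<in> ?A" "b \<in> ?A"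
    then obtain K W K' W' where *: "cylinder K W a" "cylinder K' W' b" by blast
    have "cylinder (max K K') (max W W') a" "cylinder (max K K') (max W W') b"
      using *[THEN cylinder_mono] by auto
    then have "cylinder (max K K') (max W W') (a \<union> b)" unfolding cylinder_def by blast
    then show "a \<union> b \<in> ?A" by blast
  qed simp
  show "sets M = sigma_sets UNIV ?A"
  proof
    show "sigma_sets UNIV ?A \<subseteq> sets M"
      using sets.sigma_sets_subset[of ?A M] by (auto simp: cylinder_def)
    \<comment> \<open>both coordinate maps, and hence the identity, are measurable from this space to \<open>M\<close>\<close>
    define N' where "N' = sigma UNIV ?A"
    have sN: "space N' = UNIV" "sets N' = sigma_sets UNIV ?A" by (simp_all add: N'_def)
    have "fst \<in> measurable N' digit_measure"
    proof (rule measurable_into_digit, rule measurableI)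
      fix k :: nat and S :: "nat set"
      have "(\<lambda>p. fst p k) -` S \<in> sets M"
        using measurable_sets[OF measurable_compose[OF measurable_fst_M measurable_digit_component], of S k]
        by (simp add: vimage_def)
      then have "cylinder (Suc k) 0 ((\<lambda>p. fst p k) -` S)" by (auto simp: cylinder_def)
      then show "(\<lambda>p. fst p k) -` S \<inter> space N' \<in> sets N'" by (auto simp: sN intro: sigma_sets.Basic)
    qed auto
    moreover have "snd \<in> measurable N' coin_measure"
    proof (rule measurable_into_coin, rule measurableI)
      fix i :: int and S :: "bool set"
      have "(\<lambda>p. snd p i) -` S \<in> sets M"
        using measurable_sets[OF measurable_compose[OF measurable_snd_M measurable_coin_component], of S i]
        by (simp add: vimage_def)
      then have "cylinder 0 (nat \<bar>i\<bar>) ((\<lambda>p. snd p i) -` S)" by (auto simp: cylinder_def)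
      then show "(\<lambda>p. snd p i) -` S \<inter> space N' \<in> sets N'" by (auto simp: sN intro: sigma_sets.Basic)
    qed auto
    ultimately have "(\<lambda>p. (fst p, snd p)) \<in> measurable N' M" unfolding M_def by (rule measurable_Pair)
    then have "A \<in> sets N'" if "A \<in> sets M" for A
      using measurable_sets[OF _ that, of "\<lambda>p. p" N'] by (simp add: sN)
    then show "sets M \<subseteq> sigma_sets UNIV ?A" by (auto simp: sN)
  qed
qed

lemma cylinder_approximation:
  assumes "A \<in> sets M" "e > 0"
  obtains K W C where "cylinder K W C" "measure M ((A - C) \<union> (C - A)) < e"
proof -
  interpret prob_space M by (rule prob_space_M)
  show ?thesis
    using approximation_by_algebra[of "{C. \<exists>K W. cylinder K W C}", OF _ _ assms] cylinders_generate that by auto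
qed

text \<open>
  Adding \<open>q k * h k\<close> to the position leaves the digits below \<open>k\<close> unchanged and adds \<open>q k\<close> to digit \<open>k\<close>. If
  there is no carry beyond digit \<open>k\<close>, the site is unchanged too. The carry occurs for \<open>q k * h k\<close>
  out of \<open>h (Suc k) = (k + 2) * q k * h k\<close> positions.
\<close>

lemma almost_return:
  assumes C: "cylinder K W C" and k: "K \<le> k"
  shows "measure M (C - (T ^^ (q k * h k)) -` C) \<le> 1 / (real k + 2)"
proof -
  interpret prob_space M by (rule prob_space_M)
  let ?m = "q k * h k"
  let ?B = "{d. \<not> position (Suc k) d + ?m < h (Suc k)}"
  have m0: "?m > 0" using h_pos[of k] q_pos[of k] by simp
  have Cs: "C \<in> sets M" using C by (simp add: cylinder_def)
  have TC: "(T ^^ n) -` C \<in> sets M" for n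
  proof -
    from measurable_sets[OF T_iterate_measurable Cs] show ?thesis by simp
  qed
  have Bs: "?B \<in> sets digit_measure"
  proof -
    have "?B = position (Suc k) -` {v. \<not> v + ?m < h (Suc k)} \<inter> space digit_measure" by auto
    then show ?thesis using measurable_sets[OF measurable_position, of "{v. \<not> v + ?m < h (Suc k)}" "Suc k"] by simp
  qed
  have good: "(T ^^ ?m) p \<in> C" if p: "p \<in> C" "fst p \<notin> ?B" "\<forall>k. fst p k < r k" for p
  proof -
    obtain d x where dx: "p = (d, x)" by (cases p)
    have d: "position (Suc k) d + ?m < h (Suc k)" "\<forall>k. d k < r k" using p dx by auto
    let ?v = "position (Suc k) d"
    have low: "add ?m d i = d i" if "i < k" for i
    proof -
      have "add ?m d i = digit i (?v + ?m)" using that by (simp add: add_eq_replace[OF d(1)] replace_def)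
      also have "\<dots> = digit i ((?v + ?m) mod h k)" using that by (rule digit_mod[symmetric])
      also have "\<dots> = digit i (?v mod h k)" by simp
      also have "\<dots> = digit i ?v" using that by (rule digit_mod)
      also have "\<dots> = d i" using that d(2) by (simp add: digit_position)
      finally show ?thesis .
    qed
    have top: "add ?m d k mod q k = d k mod q k"
    proof -
      have "add ?m d k = digit k (?v + ?m)" by (simp add: add_eq_replace[OF d(1)] replace_def)
      also have "\<dots> = (?v div h k + q k) mod r k" by (simp add: digit_def add.commute)
      finally have "add ?m d k mod q k = (?v div h k) mod q k" by simp
      also have "\<dots> = digit k ?v mod q k" by (simp add: digit_def)
      also have "\<dots> = d k mod q k" using d(2) by (simp add: digit_position)
      finally show ?thesis .
    qed
    have "site (Suc k) (add ?m d) = site (Suc k) d"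
      by (rule site_cong) (use low top in \<open>auto simp: less_Suc_eq\<close>)
    moreover have "(T ^^ ?m) (d, x) = (add ?m d, shift_by (site (Suc k) (add ?m d) - site (Suc k) d) x)"
      using T_iterate[of "Suc k" d "?m - 1" x] d(1) unfolding Suc_diff_1[OF m0] .
    ultimately have "(T ^^ ?m) (d, x) = (add ?m d, x)" by (simp only: diff_self shift_by_0)
    moreover have "\<forall>i<K. add ?m d i = d i" using low k by simp
    then have "(add ?m d, x) \<in> C \<longleftrightarrow> (d, x) \<in> C"
      using C unfolding cylinder_def by blast
    ultimately show ?thesis using p dx by simp
  qed
  have "prob (C - (T ^^ ?m) -` C) \<le> prob (?B \<times> UNIV)"
  proof (rule finite_measure_mono_AE)
    show "AE p in M. p \<in> C - (T ^^ ?m) -` C \<longrightarrow> p \<in> ?B \<times> UNIV"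
      using AE_M_digits by eventually_elim (use good in auto)
    show "?B \<times> UNIV \<in> sets M" unfolding M_def using Bs by (intro pair_measureI) auto
  qed
  also have "\<dots> = measure digit_measure ?B"
  proof -
    interpret X: prob_space coin_measure by (rule prob_space_coin)
    have "emeasure M (?B \<times> UNIV) = emeasure digit_measure ?B"
      unfolding M_def using X.emeasure_pair_measure_Times[OF Bs, of UNIV] X.emeasure_space_1 by simp
    then show ?thesis by (simp add: measure_def)
  qed
  also have "\<dots> = ?m / h (Suc k)" by (rule measure_overflow) (simp add: h_Suc r_def)
  also have "\<dots> = 1 / (real k + 2)"
  proof -
    have "real (h (Suc k)) = real ?m * (real k + 2)" by (simp add: h_Suc r_def algebra_simps)
    moreover have "real ?m \<noteq> 0" using m0 by linarith
    ultimately show ?thesis by (simp add: add.commute)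
  qed
  finally show ?thesis .
qed

lemma rigid_T: "rigid_map M T"
  unfolding rigid_map_def
proof (intro exI[of _ "\<lambda>k. q k * h k"] conjI allI ballI)
  interpret prob_space M by (rule prob_space_M)
  show "1 \<le> q k * h k" for k using h_pos[of k] q_pos[of k] by (simp add: Suc_le_eq)
  fix A assume A: "A \<in> sets M"
  note mp = measure_preserving_T
  note Tm = T_iterate_measurable
  have pre: "(T ^^ n) -` B \<in> sets M" "prob ((T ^^ n) -` B) = prob B" if "B \<in> sets M" for B n
  proof -
    show s: "(T ^^ n) -` B \<in> sets M" for n using measurable_sets[OF Tm that] by simp
    show "prob ((T ^^ n) -` B) = prob B"
    proof (induction n)
      case (Suc n)
      have "(T ^^ Suc n) -` B = T -` ((T ^^ n) -` B) \<inter> space M" by (simp add: funpow_Suc_right vimage_comp del: funpow.simps)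
      then show ?case using mp s[of n] Suc unfolding measure_preserving_map_def measure_def by simp
    qed simp
  qed
  show "(\<lambda>k. prob (A \<inter> ((T ^^ (q k * h k)) -` A \<inter> space M))) \<longlonglongrightarrow> prob A"
  proof (rule LIMSEQ_I)
    fix e :: real assume e: "e > 0"
    obtain K W C where C: "cylinder K W C" "prob ((A - C) \<union> (C - A)) < e / 3"
      by (rule cylinder_approximation[OF A, of "e / 3"]) (use e in auto)
    have Cs: "C \<in> sets M" using C by (simp add: cylinder_def)
    obtain k0 :: nat where k0: "1 / (real k0 + 2) < e / 3"
    proof -
      obtain k0 :: nat where "3 / e < k0" using reals_Archimedean2 by blast
      then have "1 / (real k0 + 2) < e / 3" using e by (simp add: field_simps)
      then show ?thesis using that by blast
    qed
    show "\<exists>no. \<forall>k\<ge>no. norm (prob (A \<inter> ((T ^^ (q k * h k)) -` A \<inter> space M)) - prob A) < e"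
    proof (intro exI[of _ "max K k0"] allI impI)
      fix k assume k: "max K k0 \<le> k"
      let ?S = "(T ^^ (q k * h k))"
      have "prob (A - ?S -` A) \<le> prob (((A - C) \<union> (C - A)) \<union> (C - ?S -` C) \<union> ?S -` ((A - C) \<union> (C - A)))"
        by (rule finite_measure_mono) (use A Cs pre in auto)
      also have "\<dots> \<le> prob ((A - C) \<union> (C - A)) + prob (C - ?S -` C) + prob (?S -` ((A - C) \<union> (C - A)))"
      proof -
        have "?S -` ((A - C) \<union> (C - A)) \<in> sets M" "C - ?S -` C \<in> sets M" using A Cs pre by auto
        then show ?thesis using A Cs
          by (meson add_right_mono measure_Un_le order_trans sets.Diff sets.Un)
      qed
      also have "prob (?S -` ((A - C) \<union> (C - A))) = prob ((A - C) \<union> (C - A))"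
        using A Cs by (intro pre(2)) auto
      finally have "prob (A - ?S -` A) < e"
      proof -
        assume *: "prob (A - ?S -` A) \<le> prob ((A - C) \<union> (C - A)) + prob (C - ?S -` C) + prob ((A - C) \<union> (C - A))"
        have "prob (C - ?S -` C) \<le> 1 / (real k + 2)" using almost_return[OF C(1), of k] k by simp
        also have "\<dots> \<le> 1 / (real k0 + 2)" using k by (intro divide_left_mono) auto
        finally show ?thesis using * C(2) k0 by linarith
      qed
      moreover have "prob (A \<inter> ?S -` A) = prob A - prob (A - ?S -` A)"
      proof -
        have "prob ((A \<inter> ?S -` A) \<union> (A - ?S -` A)) = prob (A \<inter> ?S -` A) + prob (A - ?S -` A)"
          using A pre by (intro finite_measure_Union) auto
        moreover have "(A \<inter> ?S -` A) \<union> (A - ?S -` A) = A" by auto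
        ultimately show ?thesis by simp
      qed
      ultimately show "norm (prob (A \<inter> (?S -` A \<inter> space M)) - prob A) < e"
        by (simp add: measure_nonneg)
    qed
  qed
qed

end

section \<open>Ergodicity\<close>

lemma invariant_iterate:
  assumes "f -` A = A"
  shows "(f ^^ n) p \<in> A \<longleftrightarrow> p \<in> A"
proof (induction n)
  case (Suc n)
  have "f y \<in> A \<longleftrightarrow> y \<in> A" for y using assms by blast
  then show ?case using Suc by simp
qed simp

context odometer
begin

text \<open>
  All points of a block lie on the forward orbit of its first point.
\<close>

lemma invariant_replace:
  assumes A: "T -` A = A" and w: "w < h K" "w' < h K"
  shows "(replace K w' d, shift_by (site K (replace K w' d) - site K (replace K w d)) x) \<in> A
     \<longleftrightarrow> (replace K w d, x) \<in> A"
proof -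
  let ?d = "replace K 0 d"
  have start: "(replace K w d, shift_by (site K (replace K w d) - site K ?d) y) \<in> A \<longleftrightarrow> (?d, y) \<in> A"
    if w: "w < h K" for w y
  proof (cases w)
    case (Suc n)
    have N0: "position K ?d = 0" by (simp add: position_replace)
    have "add (Suc n) ?d = replace K w d"
      using add_eq_replace[of K ?d "Suc n"] w Suc by (simp add: N0 replace_replace)
    then have "(T ^^ Suc n) (?d, y) = (replace K w d, shift_by (site K (replace K w d) - site K ?d) y)"
      using T_iterate[of K ?d n y] w Suc by (simp add: N0)
    then show ?thesis using invariant_iterate[OF A] by metis
  qed simp
  show ?thesis
    using start[OF w(1), of "shift_by (site K ?d - site K (replace K w d)) x"]
      start[OF w(2), of "shift_by (site K ?d - site K (replace K w d)) x"]
    by simp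
qed

text \<open>
  Adds \<open>j\<close> cyclically to the position in the level-\<open>K\<close> block, which makes the low digits independent of
  their old values when \<open>j\<close> is averaged, and adds \<open>2\<close> to digit \<open>K\<close>, which moves the observer far away.
\<close>

definition mix_position :: "nat \<Rightarrow> nat \<Rightarrow> nat \<Rightarrow> nat" where
  "mix_position K j v = (v mod h K + j) mod h K + h K * ((v div h K + 2) mod r K)"

definition mix :: "nat \<Rightarrow> nat \<Rightarrow> (nat \<Rightarrow> nat) \<Rightarrow> nat \<Rightarrow> nat" where
  "mix K j d = replace (Suc K) (mix_position K j (position (Suc K) d)) d"

definition mix_map :: "nat \<Rightarrow> nat \<Rightarrow> (nat \<Rightarrow> nat) \<times> (int \<Rightarrow> bool) \<Rightarrow> (nat \<Rightarrow> nat) \<times> (int \<Rightarrow> bool)" where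
  "mix_map K j = (\<lambda>(d, x). (mix K j d, shift_by (site (Suc K) (mix K j d) - site (Suc K) d) x))"

lemma mix_position_less: "mix_position K j v < h (Suc K)"
proof -
  have "(v mod h K + j) mod h K < h K" by simp
  moreover have "h K * ((v div h K + 2) mod r K) + h K \<le> h K * r K"
  proof -
    have "(v div h K + 2) mod r K + 1 \<le> r K" by (simp add: Suc_leI)
    then have "h K * ((v div h K + 2) mod r K + 1) \<le> h K * r K" by (rule mult_left_mono) simp
    then show ?thesis by simp
  qed
  ultimately show ?thesis unfolding mix_position_def h_Suc by linarith
qed

lemma mix_position_mod: "mix_position K j v mod h K = (v mod h K + j) mod h K"
  and mix_position_div: "mix_position K j v div h K = (v div h K + 2) mod r K"
  by (simp_all add: mix_position_def)

lemma bij_mix_position: "bij_betw (mix_position K j) {..<h (Suc K)} {..<h (Suc K)}"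
proof -
  have "inj_on (mix_position K j) {..<h (Suc K)}"
  proof (rule inj_onI)
    fix v w assume v: "v \<in> {..<h (Suc K)}" and w: "w \<in> {..<h (Suc K)}"
      and eq: "mix_position K j v = mix_position K j w"
    have e1: "(v mod h K + j) mod h K = (w mod h K + j) mod h K"
      unfolding mix_position_mod[symmetric] eq ..
    have e2: "(v div h K + 2) mod r K = (w div h K + 2) mod r K"
      unfolding mix_position_div[symmetric, of _ _ j] eq ..
    have vw: "v div h K < r K" "w div h K < r K"
      using v w by (simp_all add: h_Suc less_mult_imp_div_less mult.commute)
    have "v mod h K = w mod h K"
      using inj_onD[OF bij_betw_imp_inj_on[OF bij_betw_add_mod] e1] by simp
    moreover have "v div h K = w div h K"
      using inj_onD[OF bij_betw_imp_inj_on[OF bij_betw_add_mod] e2] vw by simp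
    ultimately show "v = w" by (metis div_mult_mod_eq)
  qed
  then show ?thesis
    by (simp add: bij_betw_def endo_inj_surj mix_position_less image_subset_iff)
qed

lemma measurable_mix: "mix K j \<in> measurable digit_measure digit_measure"
proof (rule measurable_into_digit)
  fix k
  show "(\<lambda>d. mix K j d k) \<in> measurable digit_measure (count_space UNIV)"
  proof (cases "k < Suc K")
    case True
    have "(\<lambda>d. digit k (mix_position K j (position (Suc K) d))) \<in> measurable digit_measure (count_space UNIV)"
      by (rule measurable_compose[OF measurable_position]) simp
    then show ?thesis using True by (simp add: mix_def replace_def)
  next
    case False
    have "(\<lambda>d. d k mod r k) \<in> measurable digit_measure (count_space UNIV)"
      by (rule measurable_compose[OF measurable_digit_component]) simp
    then show ?thesis using False by (simp add: mix_def replace_def)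
  qed
qed

lemma distr_mix: "distr digit_measure digit_measure (mix K j) = digit_measure"
proof (rule distr_digit_map[where L = "Suc K" and
      s = "\<lambda>J v. mix_position K j (v mod h (Suc K)) + (v - v mod h (Suc K))"])
  show "mix K j d k < r k" for d k by (simp add: mix_def replace_def)
  fix J assume J: "Suc K \<le> J"
  show "bij_betw (\<lambda>v. mix_position K j (v mod h (Suc K)) + (v - v mod h (Suc K))) {..<h J} {..<h J}"
    by (rule bij_betw_blockwise[OF bij_mix_position h_dvd[OF J]])
  show "position J (mix K j d) = mix_position K j (position J d mod h (Suc K)) + (position J d - position J d mod h (Suc K))" for d
    unfolding mix_def by (simp only: position_replace[OF mix_position_less J] position_mod[OF J])
qed (rule measurable_mix)

lemma measure_preserving_mix_map: "measure_preserving_map M (mix_map K j)"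
  unfolding mix_map_def
  by (rule skew_product_preserves[OF measurable_mix distr_mix measurable_site_diff[OF measurable_mix]])

lemma invariant_mix_map:
  assumes A: "T -` A = A" and d: "\<forall>k. d k < r k"
  shows "mix_map K j (d, x) \<in> A \<longleftrightarrow> (d, x) \<in> A"
proof -
  have "replace (Suc K) (position (Suc K) d) d = d" using d by (intro replace_position) simp
  then show ?thesis
    using invariant_replace[OF A position_less[of "Suc K" d] mix_position_less[of K j "position (Suc K) d"], of d x]
    by (simp add: mix_map_def mix_def)
qed

text \<open>
  The digits below \<open>K\<close> move the site by less than \<open>sites K\<close>, and digit \<open>K\<close> moves it by at least twice this
  amount.
\<close>

lemma mix_displacement: "int (sites K) < \<bar>site (Suc K) (mix K j d) - site (Suc K) d\<bar>"
proof -
  let ?e = "mix K j d"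
  let ?z = "d K mod q K" and ?z' = "?e K mod q K"
  have "?e K = digit K (mix_position K j (position (Suc K) d))" by (simp add: mix_def replace_def)
  also have "\<dots> = (position (Suc K) d div h K + 2) mod r K mod r K" by (simp only: digit_def mix_position_div)
  also have "position (Suc K) d div h K = d K mod r K" using position_less[of K d] by (simp add: position_Suc)
  finally have "?z' = (d K mod r K + 2) mod q K" by simp
  then have z': "?z' = (?z + 2) mod q K" by (metis mod_add_left_eq mod_r_mod_q)
  have z: "?z < q K" by simp
  have "2 \<le> \<bar>int ?z' - int ?z\<bar>"
  proof (cases "?z + 2 < q K")
    case False
    have "(?z + 2) mod q K = (?z + 2 - q K) mod q K" using False by (intro le_mod_geq) simp
    also have "\<dots> = ?z + 2 - q K" using z q_ge_4[of K] by (intro mod_less) linarith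
    finally have "(?z + 2) mod q K = ?z + 2 - q K" .
    then show ?thesis using z' False q_ge_4[of K] by linarith
  qed (simp add: z')
  then have "2 * int (sites K) \<le> \<bar>int ?z' - int ?z\<bar> * int (sites K)" by (rule mult_right_mono) simp
  then have big: "2 * int (sites K) \<le> \<bar>(int ?z' - int ?z) * int (sites K)\<bar>" by (simp add: abs_mult)
  have "site (Suc K) ?e - site (Suc K) d = (site K ?e - site K d) + (int ?z' - int ?z) * int (sites K)"
    by (simp add: site_Suc algebra_simps)
  moreover have "\<bar>site K ?e - site K d\<bar> < int (sites K)"
    using site_nonneg[of K d] site_less[of K d] site_nonneg[of K ?e] site_less[of K ?e] by linarith
  ultimately show ?thesis using big by linarith
qed

lemma position_mix: "position K (mix K j d) = (position K d + j) mod h K"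
proof -
  have "position K (mix K j d) = position (Suc K) (mix K j d) mod h K" by (simp add: position_mod)
  also have "position (Suc K) (mix K j d) = mix_position K j (position (Suc K) d)"
    unfolding mix_def position_replace[OF mix_position_less order_refl] by simp
  finally show ?thesis by (simp add: mix_position_mod position_mod)
qed

lemma cylinder_cong:
  assumes "cylinder K W C" "\<And>i. i < K \<Longrightarrow> d i = d' i" "\<And>i. \<bar>i\<bar> \<le> int W \<Longrightarrow> x i = x' i"
  shows "(d, x) \<in> C \<longleftrightarrow> (d', x') \<in> C"
proof -
  have "(\<forall>i<K. d i = d' i) \<and> (\<forall>i. \<bar>i\<bar> \<le> int W \<longrightarrow> x i = x' i) \<longrightarrow> ((d, x) \<in> C \<longleftrightarrow> (d', x') \<in> C)"
    using assms(1) unfolding cylinder_def by (elim conjE allE)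
  then show ?thesis using assms(2,3) by simp
qed

text \<open>
  Fubini's theorem for sets whose fibers have a measure that depends only on the position.
\<close>

lemma measure_by_fibers:
  assumes E: "E \<in> sets M" and F: "\<And>v. 0 \<le> F v"
    and fib: "\<And>d. (\<forall>k. d k < r k) \<Longrightarrow> measure coin_measure (Pair d -` E) = F (position K d)"
  shows "measure M E = (\<Sum>v<h K. F v) / h K"
proof -
  interpret X: prob_space coin_measure by (rule prob_space_coin)
  have "emeasure M E = (\<integral>\<^sup>+d. emeasure coin_measure (Pair d -` E) \<partial>digit_measure)"
    unfolding M_def by (rule X.emeasure_pair_measure_alt) (use E in \<open>simp add: M_def\<close>)
  also have "\<dots> = (\<integral>\<^sup>+d. ennreal (F (position K d)) \<partial>digit_measure)"
    by (rule nn_integral_cong_AE, use AE_digits_less in eventually_elim)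
      (simp add: X.emeasure_eq_measure fib)
  also have "\<dots> = (\<integral>\<^sup>+v. ennreal (F v) \<partial>distr digit_measure (count_space UNIV) (position K))"
    by (subst nn_integral_distr) auto
  also have "\<dots> = (\<Sum>v<h K. ennreal (F v)) / card {..<h K}"
    unfolding distr_position using h_pos[of K] by (intro nn_integral_pmf_of_set) (auto simp: lessThan_empty_iff)
  also have "\<dots> = ennreal ((\<Sum>v<h K. F v) / h K)"
    using F h_pos[of K] by (simp add: sum_nonneg divide_ennreal ennreal_of_nat_eq_real_of_nat)
  finally show ?thesis by (simp add: measure_def sum_nonneg F)
qed

text \<open>
  For a fixed \<open>j\<close> the windows seen before and after the map are disjoint, so on each fiber the measure
  of the intersection is a product of two fiber measures, at the positions \<open>v\<close> and \<open>v + j\<close>. Summing over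
  all \<open>j\<close> separates the two factors.
\<close>

lemma mixing_average:
  assumes C: "cylinder K W C" and W: "2 * W \<le> sites K"
  shows "(\<Sum>j<h K. measure M (C \<inter> mix_map K j -` C)) = h K * (measure M C)\<^sup>2"
proof -
  interpret X: prob_space coin_measure by (rule prob_space_coin)
  have Cs: "C \<in> sets M" using C by (simp add: cylinder_def)
  define G where "G v = {x. (\<lambda>i. digit i v, x) \<in> C}" for v
  define g where "g v = measure coin_measure (G v)" for v
  have slice: "(d, x) \<in> C \<longleftrightarrow> x \<in> G (position K d)" if "\<forall>k. d k < r k" for d x
  proof -
    have "\<forall>i<K. d i = digit i (position K d)" using that by (simp add: digit_position)
    then have "(d, x) \<in> C \<longleftrightarrow> ((\<lambda>i. digit i (position K d)), x) \<in> C"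
      by (intro cylinder_cong[OF C]) auto
    then show ?thesis by (simp only: G_def mem_Collect_eq)
  qed
  have Gs: "G v \<in> sets coin_measure" for v
  proof -
    have "G v = Pair (\<lambda>i. digit i v) -` C" by (auto simp: G_def)
    then show ?thesis using sets_Pair1[of C digit_measure coin_measure] Cs by (simp add: M_def)
  qed
  have Gw: "x \<in> G v \<longleftrightarrow> y \<in> G v" if "\<And>i. i \<in> {i. \<bar>i\<bar> \<le> int W} \<Longrightarrow> x i = y i" for x y v
  proof -
    have "((\<lambda>i. digit i v), x) \<in> C \<longleftrightarrow> ((\<lambda>i. digit i v), y) \<in> C"
      by (rule cylinder_cong[OF C]) (use that in auto)
    then show ?thesis by (simp only: G_def mem_Collect_eq)
  qed
  have mC: "measure M C = (\<Sum>v<h K. g v) / h K"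
  proof (rule measure_by_fibers[OF Cs])
    fix d assume "\<forall>k. d k < r k"
    then have "Pair d -` C = G (position K d)" using slice by auto
    then show "measure coin_measure (Pair d -` C) = g (position K d)" by (simp add: g_def)
  qed (simp add: g_def)
  have mj: "measure M (C \<inter> mix_map K j -` C) = (\<Sum>v<h K. g v * g ((v + j) mod h K)) / h K" for j
  proof (rule measure_by_fibers)
    have "mix_map K j \<in> measurable M M" using measure_preserving_mix_map by (simp add: measure_preserving_map_def)
    then show "C \<inter> mix_map K j -` C \<in> sets M" using measurable_sets[OF _ Cs] Cs by fastforce
    fix d assume d: "\<forall>k. d k < r k"
    let ?c = "site (Suc K) (mix K j d) - site (Suc K) d"
    let ?w = "(position K d + j) mod h K"
    have md: "\<forall>k. mix K j d k < r k" by (simp add: mix_def replace_def)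
    have fib: "Pair d -` (C \<inter> mix_map K j -` C) = G (position K d) \<inter> shift_by ?c -` G ?w"
      using slice[OF d] slice[OF md] by (auto simp: mix_map_def position_mix)
    have "measure coin_measure (G (position K d) \<inter> shift_by ?c -` G ?w)
        = measure coin_measure (G (position K d)) * measure coin_measure (shift_by ?c -` G ?w)"
    proof (rule coin_windows_independent[where I = "{i. \<bar>i\<bar> \<le> int W}" and J = "{i. \<bar>i - ?c\<bar> \<le> int W}"])
      show "shift_by ?c -` G ?w \<in> sets coin_measure" using measurable_sets[OF measurable_shift Gs] by simp
      show "{i. \<bar>i\<bar> \<le> int W} \<inter> {i. \<bar>i - ?c\<bar> \<le> int W} = {}"
        using mix_displacement[of K j d] W by auto
      fix x y :: "int \<Rightarrow> bool" assume "\<And>i. i \<in> {i. \<bar>i - ?c\<bar> \<le> int W} \<Longrightarrow> x i = y i"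
      then show "x \<in> shift_by ?c -` G ?w \<longleftrightarrow> y \<in> shift_by ?c -` G ?w"
        unfolding vimage_eq by (intro Gw) (simp add: shift_by_def)
    qed (rule Gs, rule Gw)
    moreover have "measure coin_measure (shift_by ?c -` G ?w) = g ?w"
    proof -
      have "measure (distr coin_measure coin_measure (shift_by ?c)) (G ?w) = measure coin_measure (shift_by ?c -` G ?w)"
        by (subst measure_distr) (auto simp: Gs measurable_shift)
      then show ?thesis by (simp add: distr_shift g_def)
    qed
    ultimately show "measure coin_measure (Pair d -` (C \<inter> mix_map K j -` C)) = g (position K d) * g ?w"
      unfolding fib by (simp only: g_def)
  qed (simp add: g_def)
  let ?S = "\<Sum>v<h K. g v"
  have "(\<Sum>j<h K. measure M (C \<inter> mix_map K j -` C)) = (\<Sum>j<h K. \<Sum>v<h K. g v * g ((v + j) mod h K)) / h K"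
    by (simp add: mj sum_divide_distrib)
  also have "(\<Sum>j<h K. \<Sum>v<h K. g v * g ((v + j) mod h K)) = (\<Sum>v<h K. g v * (\<Sum>j<h K. g ((j + v) mod h K)))"
    by (subst sum.swap) (simp add: sum_distrib_left add.commute)
  also have "\<dots> = (\<Sum>v<h K. g v * ?S)"
    by (simp add: sum.reindex_bij_betw[OF bij_betw_add_mod])
  also have "\<dots> = ?S * ?S" by (simp add: sum_distrib_right)
  also have "?S * ?S / h K = h K * (measure M C)\<^sup>2"
    using h_pos[of K] by (simp add: mC power2_eq_square)
  finally show ?thesis .
qed

text \<open>
  An invariant set \<open>A\<close> is, up to null sets, preserved by all \<open>mix_map K j\<close>. Replacing it by a cylinder
  that is close to it, the previous lemma shows that the measure of \<open>A\<close> is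
  arbitrarily close to its own square.
\<close>

lemma ergodic_T: "ergodic_map M T"
  unfolding ergodic_map_def
proof (intro conjI measure_preserving_T ballI impI)
  interpret prob_space M by (rule prob_space_M)
  fix A assume A: "A \<in> sets M" and "T -` A \<inter> space M = A"
  then have inv: "T -` A = A" by simp
  have bound: "\<bar>prob A - (prob A)\<^sup>2\<bar> \<le> 4 * e" if e: "e > 0" for e
  proof -
    obtain K0 W C where C0: "cylinder K0 W C" and close: "prob ((A - C) \<union> (C - A)) < e"
      by (rule cylinder_approximation[OF A e])
    define K where "K = max K0 (2 * W)"
    have C: "cylinder K W C" by (rule cylinder_mono[OF C0]) (auto simp: K_def)
    have W: "2 * W \<le> sites K" using sites_ge[of K] by (simp add: K_def)
    have Cs: "C \<in> sets M" using C by (simp add: cylinder_def)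
    let ?D = "(A - C) \<union> (C - A)"
    have AC: "\<bar>prob A - prob C\<bar> \<le> e"
    proof -
      have "prob A \<le> prob (C \<union> ?D)" "prob C \<le> prob (A \<union> ?D)"
        by (rule finite_measure_mono; use A Cs in auto)+
      moreover have "prob (C \<union> ?D) \<le> prob C + prob ?D" "prob (A \<union> ?D) \<le> prob A + prob ?D"
        using A Cs by (auto intro!: measure_Un_le)
      ultimately show ?thesis using close by linarith
    qed
    have each: "\<bar>prob A - prob (C \<inter> mix_map K j -` C)\<bar> \<le> 2 * e" for j
    proof -
      let ?f = "mix_map K j"
      have fm: "?f \<in> measurable M M" using measure_preserving_mix_map by (simp add: measure_preserving_map_def)
      have fs: "?f -` B \<in> sets M" if "B \<in> sets M" for B using measurable_sets[OF fm that] by simp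
      have fD: "prob (?f -` ?D) = prob ?D"
        using measure_preserving_map_iterate(2)[OF measure_preserving_mix_map, of ?D 1] A Cs by simp
      have "AE p in M. p \<in> ?f -` A \<longleftrightarrow> p \<in> A"
        using AE_M_digits by eventually_elim (use invariant_mix_map[OF inv] in auto)
      then have "prob (A \<inter> ?f -` A) = prob A"
        by (intro finite_measure_eq_AE) (auto simp: A fs elim!: eventually_mono)
      moreover have "prob (A \<inter> ?f -` A) \<le> prob ((C \<inter> ?f -` C) \<union> (?D \<union> ?f -` ?D))"
        "prob (C \<inter> ?f -` C) \<le> prob ((A \<inter> ?f -` A) \<union> (?D \<union> ?f -` ?D))"
        by (rule finite_measure_mono; use A Cs fs in auto)+
      moreover have "prob (B \<union> (?D \<union> ?f -` ?D)) \<le> prob B + (prob ?D + prob (?f -` ?D))" if "B \<in> sets M" for B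
      proof -
        have s: "?D \<in> sets M" "?f -` ?D \<in> sets M" using A Cs fs by auto
        show ?thesis using measure_Un_le[OF that sets.Un[OF s]] measure_Un_le[OF s] by linarith
      qed
      ultimately show ?thesis using close fD A Cs fs by (smt (verit) sets.Int)
    qed
    have "\<bar>h K * prob A - h K * (prob C)\<^sup>2\<bar> = \<bar>\<Sum>j<h K. prob A - prob (C \<inter> mix_map K j -` C)\<bar>"
      unfolding mixing_average[OF C W, symmetric] by (simp add: sum_subtractf)
    also have "\<dots> \<le> (\<Sum>j<h K. 2 * e)"
      by (rule order_trans[OF sum_abs sum_mono[OF each]])
    also have "\<dots> = h K * (2 * e)" by simp
    finally have "h K * \<bar>prob A - (prob C)\<^sup>2\<bar> \<le> h K * (2 * e)"
      by (simp add: abs_mult right_diff_distrib[symmetric])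
    then have 1: "\<bar>prob A - (prob C)\<^sup>2\<bar> \<le> 2 * e" using h_pos[of K] by simp
    have "\<bar>(prob A)\<^sup>2 - (prob C)\<^sup>2\<bar> = \<bar>prob A - prob C\<bar> * (prob A + prob C)"
    proof -
      have "(prob A)\<^sup>2 - (prob C)\<^sup>2 = (prob A - prob C) * (prob A + prob C)"
        by (simp add: power2_eq_square algebra_simps)
      then show ?thesis by (simp add: abs_mult)
    qed
    also have "\<dots> \<le> e * 2"
    proof (rule mult_mono)
      show "prob A + prob C \<le> 2" using prob_le_1[of A] prob_le_1[of C] by linarith
    qed (use AC e in auto)
    finally show ?thesis using 1 by linarith
  qed
  have "\<bar>prob A - (prob A)\<^sup>2\<bar> \<le> 0"
  proof (rule field_le_epsilon)
    fix e :: real assume "e > 0"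
    then show "\<bar>prob A - (prob A)\<^sup>2\<bar> \<le> 0 + e" using bound[of "e / 4"] by simp
  qed
  then have "prob A * (1 - prob A) = 0" by (simp add: power2_eq_square algebra_simps)
  then show "prob A = 0 \<or> prob A = 1" by simp
qed

end

section \<open>The flipped conjugate and the counterexample\<close>

definition flip_map :: "'a \<times> (int \<Rightarrow> bool) \<Rightarrow> 'a \<times> (int \<Rightarrow> bool)" where
  "flip_map = (\<lambda>(d, x). (d, flip_off_origin x))"

definition marked :: "('a \<times> (int \<Rightarrow> bool)) set" where
  "marked = {p. snd p 0}"

lemma flip_map_flip_map [simp]: "flip_map (flip_map p) = p"
  by (cases p) (simp add: flip_map_def)

lemma completely_metrizable_pair_space:
  "completely_metrizable_space (euclidean :: ((nat \<Rightarrow> nat) \<times> (int \<Rightarrow> bool)) topology)"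
  by (simp add: completely_metrizable_space_prod_topology completely_metrizable_euclidean_fun
      flip: prod_topology_euclidean)

context odometer
begin

lemma AE_no_overflow: "AE d in digit_measure. \<exists>K. position K d + n < h K"
proof -
  interpret prob_space digit_measure by (rule prob_space_digit)
  let ?B = "\<lambda>K. {d. \<not> position K d + n < h K}"
  have Bs: "?B K \<in> events" for K
    using measurable_sets[OF measurable_position, of "{v. \<not> v + n < h K}" K] by (simp add: vimage_def)
  have Is: "(\<Inter>K. ?B K) \<in> events" using Bs by auto
  have "prob (\<Inter>K. ?B K) \<le> 0"
  proof (rule field_le_epsilon)
    fix e :: real assume e: "e > 0"
    have "(\<lambda>K. real n / 2 ^ K) \<longlonglongrightarrow> 0" by real_asymp
    then have "\<forall>\<^sub>F K in sequentially. real n / 2 ^ K < e" using e by (rule order_tendstoD)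
    moreover have "\<forall>\<^sub>F K in sequentially. n \<le> (2::nat) ^ K"
      using eventually_ge_at_top[of n] by eventually_elim (meson less_exp less_imp_le order_trans)
    ultimately obtain K where K: "real n / 2 ^ K < e" "n \<le> 2 ^ K"
      by (metis (mono_tags, lifting) eventually_conj eventually_happens trivial_limit_sequentially)
    have "prob (\<Inter>K. ?B K) \<le> prob (?B K)" using Bs by (intro finite_measure_mono) auto
    also have "\<dots> = n / h K" using K(2) h_ge[of K] by (intro measure_overflow) simp
    also have "\<dots> \<le> n / 2 ^ K"
    proof -
      have "(2::real) ^ K \<le> real (h K)" using h_ge[of K] by (metis of_nat_le_iff of_nat_numeral of_nat_power)
      then show ?thesis by (intro divide_left_mono) auto
    qed
    finally show "prob (\<Inter>K. ?B K) \<le> 0 + e" using K(1) by simp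
  qed
  then have "prob (\<Inter>K. ?B K) = 0" using measure_nonneg[of digit_measure "\<Inter>K. ?B K"] by linarith
  then have "(\<Inter>K. ?B K) \<in> null_sets digit_measure" using Is by (simp add: null_setsI emeasure_eq_measure)
  then have "AE d in digit_measure. d \<notin> (\<Inter>K. ?B K)" by (rule AE_not_in)
  then show ?thesis by eventually_elim auto
qed

text \<open>
  The displacement \<open>c\<close> after \<open>a\<close> steps is the same for \<open>p\<close> and \<open>flip_map p\<close>, as it depends only on the digits,
  and it is nonzero by \<open>no_return\<close>. So the two maps look at opposite faces of the same coin.
\<close>

lemma AE_no_triple_return:
  assumes S: "spread S" "a \<in> S" "a > 0"
  shows "AE p in M. \<not> (p \<in> marked \<and> (T ^^ a) p \<in> marked \<and> flip_map ((T ^^ a) (flip_map p)) \<in> marked)"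
  using AE_M_fst[OF AE_no_overflow[of a]]
proof eventually_elim
  fix p :: "(nat \<Rightarrow> nat) \<times> (int \<Rightarrow> bool)"
  assume "\<exists>K. position K (fst p) + a < h K"
  then obtain K where K: "position K (fst p) + a < h K" by blast
  obtain d x where p: "p = (d, x)" by (cases p)
  let ?c = "site K (add a d) - site K d"
  have T: "(T ^^ a) (d, y) = (add a d, shift_by ?c y)" for y
    using T_iterate[of K d "a - 1" y] K p unfolding Suc_diff_1[OF S(3)] by simp
  have "position K (add a d) = position K d + a" using K p by (simp add: position_add)
  then have c: "?c \<noteq> 0" using no_return[OF S, of K d "add a d"] by auto
  show "\<not> (p \<in> marked \<and> (T ^^ a) p \<in> marked \<and> flip_map ((T ^^ a) (flip_map p)) \<in> marked)"
    using c by (simp add: p T flip_map_def marked_def shift_by_def flip_off_origin_def)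
qed

lemma marked_sets: "marked \<in> sets M" and measure_marked: "measure M marked = 1 / 2"
proof -
  interpret X: prob_space coin_measure by (rule prob_space_coin)
  let ?H = "{x :: int \<Rightarrow> bool. x 0}"
  have H: "?H \<in> sets coin_measure"
    using measurable_sets[OF measurable_coin_component, of "{True}" 0] by (simp add: vimage_def)
  have eq: "marked = UNIV \<times> ?H" by (auto simp: marked_def)
  have D: "UNIV \<in> sets digit_measure" using sets.top[of digit_measure] by simp
  show s: "marked \<in> sets M" unfolding eq M_def using D H by (rule pair_measureI)
  have "measure M marked = (\<Sum>v<h 0. measure coin_measure ?H) / h 0"
    by (rule measure_by_fibers[OF s]) (auto simp: marked_def vimage_def)
  moreover have half: "emeasure coin_measure ?H = ennreal (1 / 2)"
    using coin.emeasure_PiM_Collect_single[of 0 "{True}"]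
    by (simp add: coin_measure_def space_PiM emeasure_pmf_single pmf_of_set)
  have "measure coin_measure ?H = 1 / 2" unfolding measure_def half by (rule enn2real_ennreal) simp
  ultimately show "measure M marked = 1 / 2" by simp
qed

lemma measure_iso_flip: "measure_iso M M flip_map flip_map"
proof -
  have g: "(\<lambda>(d, x). flip_off_origin x) \<in> measurable (digit_measure \<Otimes>\<^sub>M coin_measure) coin_measure"
    unfolding split_def by (rule measurable_compose[OF measurable_snd measurable_flip])
  have d: "distr digit_measure digit_measure (\<lambda>d. d) = digit_measure" by (rule distr_id)
  show ?thesis
    using distr_skew_product[OF prob_space_digit prob_space_coin measurable_ident_sets[OF refl] d distr_flip g]
    unfolding measure_iso_def M_def[symmetric] flip_map_def[symmetric] by simp
qed

end

lemma measure_iso_comp: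
  assumes "measure_iso M N f g" "measure_iso M M f' g'"
  shows "measure_iso M N (f \<circ> f') (g' \<circ> g)"
proof -
  have f: "f \<in> measurable M N" "g \<in> measurable N M" "distr M N f = N"
    and f': "f' \<in> measurable M M" "g' \<in> measurable M M" "distr M M f' = M"
    using assms by (auto simp: measure_iso_def)
  have "distr M N (f \<circ> f') = distr (distr M M f') N f" by (rule distr_distr[OF f(1) f'(1), symmetric])
  then have "distr M N (f \<circ> f') = N" using f f' by simp
  then show ?thesis
    using assms measurable_comp[OF f'(1) f(1)] measurable_comp[OF f(2) f'(2)]
      measurable_space[OF f'(1)] measurable_space[OF f(2)]
    by (auto simp: measure_iso_def)
qed

theorem theorem1p4:
  shows "\<exists>M :: real. M > 0 \<and>
    (\<forall>L d :: nat. real L > M \<and> d \<ge> 3 \<longrightarrow>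
      (\<exists>(\<mu> :: real measure) T S A.
        standard_probability_space \<mu> \<and>
        ergodic_map \<mu> T \<and> ergodic_map \<mu> S \<and>
        ks_entropy \<mu> T = 0 \<and> ks_entropy \<mu> S = 0 \<and>
        A \<in> sets \<mu> \<and> measure \<mu> A > 0 \<and>
        (\<forall>n :: nat. n \<ge> 1 \<longrightarrow>
          measure \<mu> (A \<inter> ((T ^^ (L * n ^ d)) -` A \<inter> space \<mu>)
                       \<inter> ((S ^^ (L * n ^ d)) -` A \<inter> space \<mu>)) = 0)))"
proof (intro exI[of _ "1::real"] conjI allI impI)
  fix L d :: nat
  assume "real L > 1 \<and> d \<ge> 3"
  then have L: "L \<ge> 1" and d: "d \<ge> 2" by auto
  define a where "a n = L * n ^ d" for n
  have "n ^ 2 \<le> a n" if "n \<ge> 1" for n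
  proof -
    have "n ^ 2 \<le> n ^ d" using that d by (intro power_increasing) auto
    also have "\<dots> \<le> L * n ^ d" using L by simp
    finally show ?thesis by (simp add: a_def)
  qed
  then obtain q where "odometer q" and "odometer.spread q (a ` {1..})"
    using odometer_avoiding by blast
  then interpret odometer q by simp
  have spread: "spread (a ` {1..})" by fact
  obtain e :: "(nat \<Rightarrow> nat) \<times> (int \<Rightarrow> bool) \<Rightarrow> real" where e: "inj e"
    using digits_and_coins_embed_in_reals by blast
  define \<mu> where "\<mu> = embed_measure M e"
  define T' where "T' = e \<circ> T \<circ> the_inv e"
  \<comment> \<open>\<open>S'\<close> is the copy of the same \<open>T\<close> under the isomorphism \<open>e \<circ> flip_map\<close>\<close>
  define S' where "S' = (e \<circ> flip_map) \<circ> T \<circ> (flip_map \<circ> the_inv e)"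
  define A where "A = e ` marked"
  note std = standard_embed_measure[OF prob_space_M sets_M e completely_metrizable_pair_space, folded \<mu>_def]
  note iso_T = std(2)
  note iso_S = measure_iso_comp[OF iso_T measure_iso_flip]
  have pm: "prob_space \<mu>" using std(1) by (simp add: standard_probability_space_def)
  interpret \<mu>: prob_space \<mu> by (rule pm)
  have erg: "ergodic_map \<mu> T'" "ergodic_map \<mu> S'"
    unfolding T'_def S'_def
    by (rule ergodic_conj[OF iso_T T_measurable ergodic_T] ergodic_conj[OF iso_S T_measurable ergodic_T])+
  have rig: "rigid_map \<mu> T'" "rigid_map \<mu> S'"
    unfolding T'_def S'_def
    by (rule rigid_conj[OF iso_T T_measurable rigid_T] rigid_conj[OF iso_S T_measurable rigid_T])+
  have mp: "measure_preserving_map \<mu> T'" "measure_preserving_map \<mu> S'"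
    using erg by (simp_all add: ergodic_map_def)
  have As: "A \<in> sets \<mu>" unfolding A_def \<mu>_def by (rule in_sets_embed_measure[OF marked_sets])
  have eA: "e p \<in> A \<longleftrightarrow> p \<in> marked" for p unfolding A_def by (rule inj_image_mem_iff[OF e])
  have mA: "measure \<mu> A = 1 / 2"
    using measure_iso_vimage[OF iso_T T_measurable As] measure_marked eA by (simp add: vimage_def)
  have null: "measure \<mu> (A \<inter> ((T' ^^ a n) -` A \<inter> space \<mu>) \<inter> ((S' ^^ a n) -` A \<inter> space \<mu>)) = 0"
    if n: "n \<ge> 1" for n
  proof -
    let ?X = "A \<inter> ((T' ^^ a n) -` A \<inter> space \<mu>) \<inter> ((S' ^^ a n) -` A \<inter> space \<mu>)"
    interpret P: prob_space M by (rule prob_space_M)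
    have Xs: "?X \<in> sets \<mu>"
      using As measurable_sets[OF measure_preserving_map_iterate(1)[OF mp(1)] As]
        measurable_sets[OF measure_preserving_map_iterate(1)[OF mp(2)] As] by blast
    have sp: "e p \<in> space \<mu>" for p by (simp add: \<mu>_def space_embed_measure)
    have inv: "the_inv e (e p) = p" for p using e by (simp add: the_inv_f_f)
    have T': "(T' ^^ k) (e p) = e ((T ^^ k) p)" for k p
      using conj_map_iterate[OF iso_T T_measurable sp[of p], of k] by (simp add: T'_def inv)
    have S': "(S' ^^ k) (e p) = e (flip_map ((T ^^ k) (flip_map p)))" for k p
      using conj_map_iterate[OF iso_S T_measurable sp[of p], of k] by (simp add: S'_def inv)
    have a0: "a n > 0" using n L by (simp add: a_def)
    have "measure M (e -` ?X \<inter> space M) \<le> measure M {}"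
    proof (rule P.finite_measure_mono_AE)
      show "AE p in M. p \<in> e -` ?X \<inter> space M \<longrightarrow> p \<in> {}"
        using AE_no_triple_return[OF spread _ a0]
        by (rule eventually_mono) (use n in \<open>auto simp: eA T' S'\<close>)
    qed simp
    then have "measure M (e -` ?X \<inter> space M) \<le> 0" by (simp only: measure_empty)
    then show ?thesis
      unfolding measure_iso_vimage[OF iso_T T_measurable Xs] using measure_nonneg by (rule antisym)
  qed
  show "\<exists>(\<mu> :: real measure) T S A.
        standard_probability_space \<mu> \<and>
        ergodic_map \<mu> T \<and> ergodic_map \<mu> S \<and>
        ks_entropy \<mu> T = 0 \<and> ks_entropy \<mu> S = 0 \<and>
        A \<in> sets \<mu> \<and> measure \<mu> A > 0 \<and>
        (\<forall>n :: nat. n \<ge> 1 \<longrightarrow>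
          measure \<mu> (A \<inter> ((T ^^ (L * n ^ d)) -` A \<inter> space \<mu>)
                       \<inter> ((S ^^ (L * n ^ d)) -` A \<inter> space \<mu>)) = 0)"
  proof (intro exI conjI allI impI)
    show "standard_probability_space \<mu>" by (rule std(1))
    show "ergodic_map \<mu> T'" "ergodic_map \<mu> S'" by (rule erg)+
    show "ks_entropy \<mu> T' = 0" "ks_entropy \<mu> S' = 0"
      by (rule ks_entropy_rigid[OF pm mp(1) rig(1)] ks_entropy_rigid[OF pm mp(2) rig(2)])+
    show "A \<in> sets \<mu>" by (rule As)
    show "measure \<mu> A > 0" by (simp add: mA)
    show "measure \<mu> (A \<inter> ((T' ^^ (L * n ^ d)) -` A \<inter> space \<mu>)
                       \<inter> ((S' ^^ (L * n ^ d)) -` A \<inter> space \<mu>)) = 0" if "n \<ge> 1" for n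
      using null[OF that] by (simp add: a_def)
  qed
qed simp

end
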